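(* Let $n\ge1$ and let $\mu$ be a partition of $n$. The coefficient of the monomial symmetric function $m_{1^n}$ in $\tilde{J}_\mu^{(\alpha)}(X)$ is $$\langle \tilde{J}_\mu^{(\alpha)}(X), h_{1^n}\rangle = n!\,\alpha^n = \sum_{k=0}^{n-1} n!\, A(n,k) \binom{\alpha + k}{n} = \sum_{k=1}^{n} n!\, S(n,k)\binom{\alpha}{k} k!.$$
   Context: Jack polynomials: over $\mathbb{Q}(\alpha)$, with $\alpha$ an indeterminate, let $\langle p_\lambda,p_\nu\rangle_\alpha=\delta_{\lambda\nu}z_\lambda\alpha^{\ell(\lambda)}$, where $z_\lambda=\prod_i i^{m_i}m_i!$ and $m_i$ is the number of parts of $\lambda$ equal to $i$. The integral form Jack symmetric functions $J_\mu^{(\alpha)}(X)$ are the unique family, indexed by partitions $\mu$, of symmetric functions that are pairwise orthogonal for $\langle\cdot,\cdot\rangle_\alpha$, are triangular (only monomial symmetric functions $m_\lambda$ with $\lambda\le\mu$ in dominance order appear in $J_\mu^{(\alpha)}$), and are normalized so that the coefficient of $m_{1^n}$ in $J_\mu^{(\alpha)}$ is $n!$ where $n=|\mu|$. For $\mu$ a partition of $n$, define $\tilde J_\mu^{(\alpha)}(X)=\alpha^nJ_\mu^{(1/\alpha)}(X)$. The bracket $\langle\cdot,\cdot\rangle$ (without subscript) is the Hall scalar product, for which Schur functions are orthonormal (extended linearly over $\mathbb{Q}(\alpha)$); $h_{1^n}=h_1^n$ is a complete homogeneous symmetric function. Binomial coefficients in $\alpha$ are polynomials in $\alpha$. $A(n,k)$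 is the Eulerian number, the number of permutations in $S_n$ with exactly $k$ descents (positions $i$ with $\pi_i>\pi_{i+1}$). $S(n,k)$ is the Stirling number of the second kind, the number of partitions of an $n$-element set into $k$ nonempty blocks. *)

theory Defs
  imports
    "HOL-Library.Multiset"
    "HOL-Library.FuncSet"
    "HOL-Library.Disjoint_Sets"
    "HOL-Combinatorics.Permutations"
    "HOL-Computational_Algebra.Computational_Algebra"
begin

section \<open>Formal power series in countably many variables\<close>

text \<open>
  A monomial in the variables \<open>x\<^sub>0, x\<^sub>1, \<dots>\<close> is encoded as the finite multiset of its
  variable indices, so the product of monomials is the union of multisets and the degree
  is the size. A formal power series assigns a coefficient to every monomial.
\<close>

typedef 'a mseries = "UNIV :: (nat multiset \<Rightarrow> 'a) set"
  morphisms mcoeff Mseries ..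

setup_lifting type_definition_mseries

lemma mseries_eq_iff: "f = g \<longleftrightarrow> (\<forall>M. mcoeff f M = mcoeff g M)"
  by transfer auto

lemma finite_msplit: "finite {(A, B). A + B = (M :: 'b multiset)}"
proof (rule finite_subset)
  show "{(A, B). A + B = M} \<subseteq> {A. A \<subseteq># M} \<times> {B. B \<subseteq># M}"
    by auto
  have "finite {A. A \<subseteq># M}"
  proof (rule finite_subset)
    show "{A. A \<subseteq># M} \<subseteq> mset ` {xs. set xs \<subseteq> set_mset M \<and> length xs \<le> size M}"
    proof
      fix A assume "A \<in> {A. A \<subseteq># M}"
      then have A: "A \<subseteq># M" by simp
      obtain xs where xs: "A = mset xs" by (metis ex_mset)
      have "set xs \<subseteq> set_mset M" using set_mset_mono[OF A] xs by simp
      moreover have "length xs \<le> size M" using size_mset_mono[OF A] xs by simp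
      ultimately show "A \<in> mset ` {xs. set xs \<subseteq> set_mset M \<and> length xs \<le> size M}"
        using xs by blast
    qed
    show "finite (mset ` {xs. set xs \<subseteq> set_mset M \<and> length xs \<le> size M})"
      by (intro finite_imageI finite_lists_length_le) simp
  qed
  then show "finite ({A. A \<subseteq># M} \<times> {B. B \<subseteq># M})" by blast
qed

instantiation mseries :: (comm_ring_1) comm_ring_1
begin

lift_definition zero_mseries :: "'a mseries" is "\<lambda>_. 0" .
lift_definition one_mseries :: "'a mseries" is "\<lambda>M. if M = {#} then 1 else 0" .
lift_definition plus_mseries :: "'a mseries \<Rightarrow> 'a mseries \<Rightarrow> 'a mseries" is
  "\<lambda>f g M. f M + g M" .
lift_definition uminus_mseries :: "'a mseries \<Rightarrow> 'a mseries" is "\<lambda>f M. - f M" .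
lift_definition minus_mseries :: "'a mseries \<Rightarrow> 'a mseries \<Rightarrow> 'a mseries" is
  "\<lambda>f g M. f M - g M" .
lift_definition times_mseries :: "'a mseries \<Rightarrow> 'a mseries \<Rightarrow> 'a mseries" is
  "\<lambda>f g M. \<Sum>(A, B) | A + B = M. f A * g B" .

instance
proof
  fix f g h :: "'a mseries"
  show "f + g + h = f + (g + h)" by transfer (simp add: add.assoc)
  show "f + g = g + f" by transfer (simp add: add.commute)
  show "0 + f = f" by transfer simp
  show "- f + f = 0" by transfer simp
  show "f - g = f + - g" by transfer simp
  show "(0 :: 'a mseries) \<noteq> 1" by transfer (metis one_neq_zero)
  show "f * g = g * f"
  proof transfer
    fix f g :: "nat multiset \<Rightarrow> 'a"
    have "(\<Sum>(A, B) | A + B = M. f A * g B) = (\<Sum>(A, B) | A + B = M. g A * f B)" for M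
      by (rule sum.reindex_bij_witness[of _ prod.swap prod.swap])
         (auto simp: add.commute mult.commute)
    then show "(\<lambda>M. \<Sum>(A, B) | A + B = M. f A * g B) = (\<lambda>M. \<Sum>(A, B) | A + B = M. g A * f B)"
      by blast
  qed
  show "1 * f = f"
  proof transfer
    fix f :: "nat multiset \<Rightarrow> 'a"
    have "(\<Sum>(A, B) | A + B = M. (if A = {#} then 1 else 0) * f B) = f M" for M
    proof -
      have "(\<Sum>(A, B) | A + B = M. (if A = {#} then 1 else 0) * f B) =
            (\<Sum>(A, B) \<in> {({#} :: nat multiset, M)}. (if A = {#} then 1 else 0) * f B)"
        by (rule sum.mono_neutral_right) (auto simp: finite_msplit split: if_splits)
      then show ?thesis by simp
    qed
    then show "(\<lambda>M. \<Sum>(A, B) | A + B = M. (if A = {#} then 1 else 0) * f B) = f"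
      by blast
  qed
  show "(f + g) * h = f * h + g * h"
    by transfer (simp add: sum.distrib case_prod_beta distrib_right)
  show "f * g * h = f * (g * h)"
  proof transfer
    fix f g h :: "nat multiset \<Rightarrow> 'a"
    have "(\<Sum>(A, B) | A + B = M. (\<Sum>(C, D) | C + D = A. f C * g D) * h B) =
          (\<Sum>(A, B) | A + B = M. f A * (\<Sum>(C, D) | C + D = B. g C * h D))" for M
    proof -
      have "(\<Sum>(A, B) | A + B = M. (\<Sum>(C, D) | C + D = A. f C * g D) * h B) =
            (\<Sum>x\<in>{(A, B). A + B = M}. \<Sum>y\<in>{(C, D). C + D = fst x}.
               f (fst y) * g (snd y) * h (snd x))"
        by (simp add: sum_distrib_right case_prod_beta)
      also have "\<dots> = (\<Sum>(x, y)\<in>Sigma {(A, B). A + B = M} (\<lambda>x. {(C, D). C + D = fst x}).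
               f (fst y) * g (snd y) * h (snd x))"
        by (rule sum.Sigma) (auto simp: finite_msplit)
      also have "\<dots> = (\<Sum>(x, y)\<in>Sigma {(A, B). A + B = M} (\<lambda>x. {(C, D). C + D = snd x}).
               f (fst x) * (g (fst y) * h (snd y)))"
        by (rule sum.reindex_bij_witness[of _
              "\<lambda>((A, B), (C, D)). ((A + C, D), (A, C))"
              "\<lambda>((A, B), (C, D)). ((C, D + B), (D, B))"])
           (auto simp: add.assoc mult.assoc)
      also have "\<dots> = (\<Sum>x\<in>{(A, B). A + B = M}. \<Sum>y\<in>{(C, D). C + D = snd x}.
               f (fst x) * (g (fst y) * h (snd y)))"
        by (rule sum.Sigma[symmetric]) (auto simp: finite_msplit)
      also have "\<dots> = (\<Sum>(A, B) | A + B = M. f A * (\<Sum>(C, D) | C + D = B. g C * h D))"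
        by (simp add: sum_distrib_left case_prod_beta)
      finally show ?thesis .
    qed
    then show "(\<lambda>M. \<Sum>(A, B) | A + B = M. (\<Sum>(C, D) | C + D = A. f C * g D) * h B) =
          (\<lambda>M. \<Sum>(A, B) | A + B = M. f A * (\<Sum>(C, D) | C + D = B. g C * h D))"
      by blast
  qed
qed

end

lift_definition scale :: "'a::comm_ring_1 \<Rightarrow> 'a mseries \<Rightarrow> 'a mseries" is
  "\<lambda>c f M. c * f M" .

lift_definition map_mcoeff :: "('a \<Rightarrow> 'b) \<Rightarrow> 'a mseries \<Rightarrow> 'b mseries" is
  "\<lambda>\<phi> f M. \<phi> (f M)" .


section \<open>Integer partitions\<close>

text \<open>
  A partition is the multiset of its (positive) parts: its weight is \<open>\<Sum>\<^sub># \<mu>\<close>, its length is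
  \<open>size \<mu>\<close>, \<open>count \<mu> i\<close> is the multiplicity of \<open>i\<close>, and \<open>1\<^sup>n\<close> is \<open>replicate_mset n 1\<close>.
\<close>

definition partition :: "nat multiset \<Rightarrow> bool" where
  "partition \<mu> \<longleftrightarrow> 0 \<notin># \<mu>"

definition partition_of :: "nat \<Rightarrow> nat multiset \<Rightarrow> bool" where
  "partition_of n \<mu> \<longleftrightarrow> partition \<mu> \<and> \<Sum>\<^sub># \<mu> = n"

definition parts :: "nat multiset \<Rightarrow> nat list" where
  "parts \<mu> = rev (sorted_list_of_multiset \<mu>)"

definition dominance_le :: "nat multiset \<Rightarrow> nat multiset \<Rightarrow> bool" where
  "dominance_le \<mu> \<nu> \<longleftrightarrow> \<Sum>\<^sub># \<mu> = \<Sum>\<^sub># \<nu> \<and>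
     (\<forall>k. sum_list (take k (parts \<mu>)) \<le> sum_list (take k (parts \<nu>)))"

definition zee :: "nat multiset \<Rightarrow> nat" where
  "zee \<mu> = (\<Prod>i\<in>set_mset \<mu>. i ^ count \<mu> i * fact (count \<mu> i))"


section \<open>Symmetric functions\<close>

definition Sym :: "'a::comm_ring_1 mseries set" where
  "Sym = {f. (\<forall>\<pi> M. bij \<pi> \<longrightarrow> mcoeff f (image_mset \<pi> M) = mcoeff f M) \<and>
             (\<exists>d. \<forall>M. mcoeff f M \<noteq> 0 \<longrightarrow> size M \<le> d)}"

text \<open>The partition formed by the nonzero exponents of a monomial.\<close>

definition exponents :: "nat multiset \<Rightarrow> nat multiset" where
  "exponents M = image_mset (count M) (mset_set (set_mset M))"

definition monomial_sf :: "nat multiset \<Rightarrow> 'a::comm_ring_1 mseries" where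
  "monomial_sf \<mu> = Mseries (\<lambda>M. if exponents M = \<mu> then 1 else 0)"

definition power_sum :: "nat \<Rightarrow> 'a::comm_ring_1 mseries" where
  "power_sum k = Mseries (\<lambda>M. if \<exists>i. M = replicate_mset k i then 1 else 0)"

definition complete_homogeneous :: "nat \<Rightarrow> 'a::comm_ring_1 mseries" where
  "complete_homogeneous k = Mseries (\<lambda>M. if size M = k then 1 else 0)"

definition power_sum_sf :: "nat multiset \<Rightarrow> 'a::comm_ring_1 mseries" where
  "power_sum_sf \<mu> = (\<Prod>k\<in>#\<mu>. power_sum k)"

definition complete_sf :: "nat multiset \<Rightarrow> 'a::comm_ring_1 mseries" where
  "complete_sf \<mu> = (\<Prod>k\<in>#\<mu>. complete_homogeneous k)"

definition cells :: "nat multiset \<Rightarrow> (nat \<times> nat) set" where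
  "cells \<mu> = {(i, j). i < size \<mu> \<and> j < parts \<mu> ! i}"

text \<open>
  Semistandard Young tableaux of shape \<open>\<mu>\<close> (rows weakly increasing, columns strictly
  increasing) whose multiset of entries is \<open>M\<close>.
\<close>

definition ssyt :: "nat multiset \<Rightarrow> nat multiset \<Rightarrow> (nat \<times> nat \<Rightarrow> nat) set" where
  "ssyt \<mu> M = {T \<in> cells \<mu> \<rightarrow>\<^sub>E UNIV.
     (\<forall>i j. (i, Suc j) \<in> cells \<mu> \<longrightarrow> T (i, j) \<le> T (i, Suc j)) \<and>
     (\<forall>i j. (Suc i, j) \<in> cells \<mu> \<longrightarrow> T (i, j) < T (Suc i, j)) \<and>
     image_mset T (mset_set (cells \<mu>)) = M}"

definition schur :: "nat multiset \<Rightarrow> 'a::comm_ring_1 mseries" where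
  "schur \<mu> = Mseries (\<lambda>M. of_nat (card (ssyt \<mu> M)))"


section \<open>Expansions in a basis and bilinear forms\<close>

text \<open>
  For a basis \<open>b\<close> of the symmetric functions indexed by partitions, \<open>coords b f \<mu>\<close> is the
  coefficient of \<open>b \<mu>\<close> in \<open>f\<close>, and \<open>diag_form b w\<close> is the bilinear form for which \<open>b\<close> is
  orthogonal with \<open>\<langle>b \<mu>, b \<mu>\<rangle> = w \<mu>\<close>. Both are meaningful only on the span of \<open>b\<close>.
\<close>

definition coords ::
  "(nat multiset \<Rightarrow> 'a::comm_ring_1 mseries) \<Rightarrow> 'a mseries \<Rightarrow> nat multiset \<Rightarrow> 'a" where
  "coords b f = (THE c. finite {\<mu>. c \<mu> \<noteq> 0} \<and> (\<forall>\<mu>. c \<mu> \<noteq> 0 \<longrightarrow> partition \<mu>) \<and>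
                        f = (\<Sum>\<mu> | c \<mu> \<noteq> 0. scale (c \<mu>) (b \<mu>)))"

definition diag_form ::
  "(nat multiset \<Rightarrow> 'a::comm_ring_1 mseries) \<Rightarrow> (nat multiset \<Rightarrow> 'a) \<Rightarrow>
     'a mseries \<Rightarrow> 'a mseries \<Rightarrow> 'a" where
  "diag_form b w f g =
     (\<Sum>\<mu> | coords b f \<mu> \<noteq> 0. coords b f \<mu> * coords b g \<mu> * w \<mu>)"

definition hall :: "'a::comm_ring_1 mseries \<Rightarrow> 'a mseries \<Rightarrow> 'a" where
  "hall = diag_form schur (\<lambda>_. 1)"


section \<open>Jack symmetric functions\<close>

type_synonym rat_fun = "rat poly fract"

definition alpha :: rat_fun where
  "alpha = Fract [:0, 1:] 1"

text \<open>
  Substitution of \<open>\<beta>\<close> for \<open>\<alpha>\<close> in a rational function that can be written with a denominator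
  not vanishing at \<open>\<beta>\<close>. For \<open>\<beta> = 1 / \<alpha>\<close>, which is transcendental over the rationals, this is
  every rational function.
\<close>

definition subst_alpha :: "rat_fun \<Rightarrow> rat_fun \<Rightarrow> rat_fun" where
  "subst_alpha \<beta> r = (THE y. \<exists>p q. r = Fract p q \<and> poly (map_poly of_rat q) \<beta> \<noteq> 0 \<and>
     y = poly (map_poly of_rat p) \<beta> / poly (map_poly of_rat q) \<beta>)"

definition jack_form :: "rat_fun mseries \<Rightarrow> rat_fun mseries \<Rightarrow> rat_fun" where
  "jack_form = diag_form power_sum_sf (\<lambda>\<mu>. of_nat (zee \<mu>) * alpha ^ size \<mu>)"

text \<open>
  The defining properties of the integral form Jack functions \<open>J\<^sub>\<mu>\<close>. They determine
  \<open>J \<mu>\<close> for every partition \<open>\<mu>\<close>; the values at other multisets are irrelevant.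
\<close>

definition jack_family :: "(nat multiset \<Rightarrow> rat_fun mseries) \<Rightarrow> bool" where
  "jack_family J \<longleftrightarrow>
     (\<forall>\<mu>. partition \<mu> \<longrightarrow> J \<mu> \<in> Sym) \<and>
     (\<forall>\<mu> \<nu>. partition \<mu> \<and> partition \<nu> \<and> \<mu> \<noteq> \<nu> \<longrightarrow> jack_form (J \<mu>) (J \<nu>) = 0) \<and>
     (\<forall>\<mu> \<nu>. partition \<mu> \<and> partition \<nu> \<and> coords monomial_sf (J \<mu>) \<nu> \<noteq> 0 \<longrightarrow>
        dominance_le \<nu> \<mu>) \<and>
     (\<forall>\<mu>. partition \<mu> \<longrightarrow>
        coords monomial_sf (J \<mu>) (replicate_mset (\<Sum>\<^sub># \<mu>) 1) = of_nat (fact (\<Sum>\<^sub># \<mu>)))"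

definition jack_tilde :: "(nat multiset \<Rightarrow> rat_fun mseries) \<Rightarrow> nat multiset \<Rightarrow> rat_fun mseries" where
  "jack_tilde J \<mu> = scale (alpha ^ (\<Sum>\<^sub># \<mu>)) (map_mcoeff (subst_alpha (1 / alpha)) (J \<mu>))"


section \<open>Eulerian and Stirling numbers\<close>

definition eulerian :: "nat \<Rightarrow> nat \<Rightarrow> nat" where
  "eulerian n k = card {\<pi>. \<pi> permutes {1..n} \<and> card {i\<in>{1..<n}. \<pi> i > \<pi> (Suc i)} = k}"

definition stirling2 :: "nat \<Rightarrow> nat \<Rightarrow> nat" where
  "stirling2 n k = card {P. partition_on {1..n} P \<and> card P = k}"

end

(*
  The coefficient of m_{1^n} in J~_mu is n! alpha^n, because substituting 1/alpha fixes the integer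
  n!. It equals <J~_mu, h_1^n>: both f |-> <f, h_1^n> and f |-> [x_0 ... x_(n-1)] f are linear, and on
  the Schur basis the former gives the coefficient of s_lambda in h_1^n (Pieri rule) and the latter
  the number of standard tableaux of shape lambda, which agree.

  Removing the largest letter of a semistandard tableau leaves a smaller shape that differs by a
  horizontal strip, so Kostka numbers are matrix entries of products of strip removal operators U_a.
  The operators commute by the Bender-Knuth involution, which makes Schur functions symmetric; the
  relation B U_a = U_a B + U_(a-1), where B sums over the ways to add a box, is the Pieri rule for
  h_1; and unitriangularity for dominance makes Schur functions a basis.

  Both expansions of alpha^n follow by induction on n, inserting the letter n+1 into a permutation
  and the element n+1 into a set partition.
*)
theory Submission
  imports Defs "HOL-Combinatorics.Multiset_Permutations"
begin

text \<open>The pairing \<open>hall\<close> is computed from \<open>coords\<close>, a definite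
  description, so no pairing can be evaluated before Schur expansions are known to exist and to be
  unique; over a commutative ring both come from unitriangular systems. Counts of tableaux are
  converted once into \<open>kostka\<close>, a product of operators on functions of row-length
  sequences, and the rest is operator calculus. The pairing rests on h_1^n = sum over \<lambda> of
  K(\<lambda>, 1^n) s_\<lambda>, proved coefficient by coefficient: multiplying by h_1 lowers one
  exponent of the monomial, summing over these choices amounts to applying B, and B, being the
  transpose of U_1, can be moved to the factor K(\<lambda>, 1^n), where it raises n. Both expansions
  of \<alpha>^n are obtained as weighted sums over permutations or set partitions, in which one
  insertion step multiplies the total by \<alpha>; grouping by descents or by blocks comes
  last.\<close>

section \<open>Eulerian and Stirling expansions of a power\<close>

fun descents :: "'a::linorder list \<Rightarrow> nat" where
  "descents (x # y # zs) = of_bool (x > y) + descents (y # zs)"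
| "descents _ = 0"

lemma descents_less_length: "xs \<noteq> [] \<Longrightarrow> descents xs < length xs"
  by (induction xs rule: descents.induct) auto

lemma descents_conv_card: "descents xs = card {i. Suc i < length xs \<and> xs ! i > xs ! Suc i}"
proof (induction xs rule: descents.induct)
  case (1 x y zs)
  let ?D = "{i. Suc i < length (y # zs) \<and> (y # zs) ! i > (y # zs) ! Suc i}"
  have "{i. Suc i < length (x # y # zs) \<and> (x # y # zs) ! i > (x # y # zs) ! Suc i}
        = (if x > y then {0} else {}) \<union> Suc ` ?D" (is "?L = ?R")
  proof (rule set_eqI)
    show "i \<in> ?L \<longleftrightarrow> i \<in> ?R" for i by (cases i) auto
  qed
  moreover have "card ((if x > y then {0} else {}) \<union> Suc ` ?D) = of_bool (x > y) + card ?D"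
    by (subst card_Un_disjoint) (auto simp: card_image)
  ultimately show ?case using 1 by simp
qed auto

definition insert_at :: "nat \<Rightarrow> 'a \<Rightarrow> 'a list \<Rightarrow> 'a list" where
  "insert_at p x xs = take p xs @ x # drop p xs"

lemma insert_at_0 [simp]: "insert_at 0 x xs = x # xs"
  and insert_at_Nil [simp]: "insert_at p x [] = [x]"
  and insert_at_Suc_Cons [simp]: "insert_at (Suc p) x (y # ys) = y # insert_at p x ys"
  by (auto simp: insert_at_def)

text \<open>The letter \<open>N\<close> makes a descent with its right neighbour and none with its
  left one. Put inside a descent or at the end, it keeps the number d of descents (d + 1 places);
  put inside one of the other \<open>length xs - d\<close> gaps, it adds one. The front is left out
  so that \<open>x\<close> stays first in the induction.\<close>

lemma sum_descents_insert_max_Cons: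
  fixes g :: "nat \<Rightarrow> 'b::comm_ring_1"
  assumes "\<forall>y\<in>set (x # xs). y < N"
  shows "(\<Sum>p = 1..length (x # xs). g (descents (insert_at p N (x # xs)))) =
    (of_nat (descents (x # xs)) + 1) * g (descents (x # xs)) +
    (of_nat (length xs) - of_nat (descents (x # xs))) * g (descents (x # xs) + 1)"
  using assms
proof (induction xs arbitrary: x g)
  case (Cons y zs)
  let ?e = "of_bool (x > y) :: nat"
  have "(\<Sum>p = 1..length (x # y # zs). g (descents (insert_at p N (x # y # zs)))) =
        (\<Sum>p = 0..length (y # zs). g (descents (x # insert_at p N (y # zs))))"
    by (rule sum.reindex_bij_witness[of _ Suc "\<lambda>p. p - 1"]) (auto simp: Suc_le_eq gr0_conv_Suc)
  also have "\<dots> = g (descents (x # N # y # zs)) +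
        (\<Sum>p = 1..length (y # zs). g (descents (x # insert_at p N (y # zs))))"
    by (subst sum.atLeast_Suc_atMost) auto
  also have "(\<Sum>p = 1..length (y # zs). g (descents (x # insert_at p N (y # zs)))) =
        (\<Sum>p = 1..length (y # zs). g (?e + descents (insert_at p N (y # zs))))"
    by (rule sum.cong) (auto simp: Suc_le_eq gr0_conv_Suc)
  also have "\<dots> = (of_nat (descents (y # zs)) + 1) * g (?e + descents (y # zs)) +
      (of_nat (length zs) - of_nat (descents (y # zs))) * g (?e + (descents (y # zs) + 1))"
    using Cons.prems by (intro Cons.IH) auto
  also have "descents (x # N # y # zs) = descents (y # zs) + 1"
    using Cons.prems by auto
  finally show ?case
    by (auto simp: algebra_simps)
qed auto

lemma sum_descents_insert_max:
  fixes g :: "nat \<Rightarrow> 'b::comm_ring_1"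
  assumes "\<forall>y\<in>set xs. y < N"
  shows "(\<Sum>p = 0..length xs. g (descents (insert_at p N xs))) =
    (of_nat (descents xs) + 1) * g (descents xs) +
    (of_nat (length xs) - of_nat (descents xs)) * g (descents xs + 1)"
proof (cases xs)
  case (Cons x ys)
  have "(\<Sum>p = 0..length xs. g (descents (insert_at p N xs))) =
        g (descents (N # xs)) + (\<Sum>p = 1..length xs. g (descents (insert_at p N xs)))"
    by (subst sum.atLeast_Suc_atMost) auto
  also have "descents (N # xs) = descents xs + 1"
    using assms Cons by auto
  finally show ?thesis
    using sum_descents_insert_max_Cons[of x ys N g] assms Cons by (simp add: algebra_simps)
qed auto

text \<open>A word on the larger set is determined by the word without \<open>x\<close> and by the
  number of letters before \<open>x\<close>, which is the position argument.\<close>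

lemma bij_betw_insert_at_permutations:
  assumes "finite A" "x \<notin> A"
  shows "bij_betw (\<lambda>(xs, p). insert_at p x xs)
           (permutations_of_set A \<times> {0..card A}) (permutations_of_set (insert x A))"
proof (rule bij_betwI[where g = "\<lambda>ys. (remove1 x ys, length (takeWhile (\<lambda>y. y \<noteq> x) ys))"])
  have *: "x \<notin> set xs" "length xs = card A" "distinct xs" "set xs = A" if "xs \<in> permutations_of_set A" for xs
    using that assms by (auto simp: permutations_of_set_def distinct_card)
  have take: "x \<notin> set (take p xs)" "x \<notin> set (drop p xs)" if "x \<notin> set xs" for xs p
    using that by (auto dest: in_set_takeD in_set_dropD)
  have set: "set (insert_at p x xs) = insert x (set xs)" "distinct (insert_at p x xs) \<longleftrightarrow> distinct xs \<and> x \<notin> set xs"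
    for xs p
  proof -
    have 1: "mset (insert_at p x xs) = add_mset x (mset xs)"
      unfolding insert_at_def by (metis append_take_drop_id mset.simps(2) mset_append union_mset_add_mset_right)
    then have "mset (insert_at p x xs) = mset (x # xs)" by simp
    from mset_eq_imp_distinct_iff[OF this] mset_eq_setD[OF this]
    show "set (insert_at p x xs) = insert x (set xs)" "distinct (insert_at p x xs) \<longleftrightarrow> distinct xs \<and> x \<notin> set xs"
      by auto
  qed
  show "(\<lambda>(xs, p). insert_at p x xs) \<in> permutations_of_set A \<times> {0..card A} \<rightarrow> permutations_of_set (insert x A)"
  proof safe
    fix xs p assume "xs \<in> permutations_of_set A"
    from *[OF this] show "insert_at p x xs \<in> permutations_of_set (insert x A)"
      by (intro permutations_of_setI) (simp_all add: set)
  qed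
  show "(\<lambda>ys. (remove1 x ys, length (takeWhile (\<lambda>y. y \<noteq> x) ys))) \<in> permutations_of_set (insert x A) \<rightarrow>
        permutations_of_set A \<times> {0..card A}"
  proof (safe, goal_cases)
    case (1 ys)
    then show ?case using assms by (auto simp: permutations_of_set_def)
  next
    case (2 ys)
    then have "distinct ys" "set ys = insert x A" by (auto simp: permutations_of_set_def)
    then have "length ys = Suc (card A)" using assms by (metis card_insert_disjoint distinct_card)
    moreover have "length (takeWhile (\<lambda>y. y \<noteq> x) ys) < length ys"
    proof -
      obtain us vs where "ys = us @ x # vs" "x \<notin> set us"
        using \<open>set ys = insert x A\<close> split_list_first[of x ys] by blast
      then show ?thesis by (auto simp: takeWhile_append)
    qed
    ultimately show ?case by auto
  qed
  show "(\<lambda>ys. (remove1 x ys, length (takeWhile (\<lambda>y. y \<noteq> x) ys))) ((\<lambda>(xs, p). insert_at p x xs) a) = a"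
    if "a \<in> permutations_of_set A \<times> {0..card A}" for a
  proof -
    obtain xs p where a': "a = (xs, p)" by (cases a)
    with that have a: "a = (xs, p)" "xs \<in> permutations_of_set A" "p \<le> card A" by auto
    have "takeWhile (\<lambda>y. y \<noteq> x) (insert_at p x xs) = take p xs"
      unfolding insert_at_def using take[OF *(1)[OF a(2)]] by (subst takeWhile_append2) auto
    moreover have "remove1 x (insert_at p x xs) = xs"
      unfolding insert_at_def using take[OF *(1)[OF a(2)]] by (simp add: remove1_append)
    ultimately show ?thesis using a *(2)[OF a(2)] by simp
  qed
  show "(\<lambda>(xs, p). insert_at p x xs) (remove1 x ys, length (takeWhile (\<lambda>y. y \<noteq> x) ys)) = ys"
    if ys: "ys \<in> permutations_of_set (insert x A)" for ys
  proof -
    from ys have "x \<in> set ys" by (auto simp: permutations_of_set_def)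
    then obtain us vs where "ys = us @ x # vs" "x \<notin> set us" by (meson split_list_first)
    moreover from this have "takeWhile (\<lambda>y. y \<noteq> x) ys = us"
      by (auto simp: takeWhile_append)
    ultimately show ?thesis by (simp add: insert_at_def remove1_append)
  qed
qed

text \<open>The weights k + 1 and n - k are the numbers of insertions that keep or raise k descents.
  With b = a + k, Pascal's rule collects n + 1 copies of (b choose n + 1), and absorption turns
  these into b - n copies of (b choose n); together with the n - k copies left over this makes
  a.\<close>

lemma gchoose_Worpitzky_step:
  fixes a :: "'a::field_char_0"
  shows "(of_nat k + 1) * ((a + of_nat k) gchoose Suc n) +
         (of_nat n - of_nat k) * ((a + of_nat (k + 1)) gchoose Suc n) = a * ((a + of_nat k) gchoose n)"
proof -
  let ?b = "a + of_nat k"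
  have "(of_nat k + 1) * (?b gchoose Suc n) + (of_nat n - of_nat k) * ((?b + 1) gchoose Suc n) =
        of_nat (Suc n) * (?b gchoose Suc n) + (of_nat n - of_nat k) * (?b gchoose n)"
    unfolding gbinomial_Suc_Suc by (simp add: algebra_simps)
  also have "of_nat (Suc n) * (?b gchoose Suc n) = (?b - of_nat n) * (?b gchoose n)"
    using gbinomial_mult_1[of ?b n] by (simp add: algebra_simps)
  finally show ?thesis by (simp add: algebra_simps)
qed

text \<open>Summing over words instead of descent numbers makes the induction local: for each word,
  the insertions of \<open>Suc n\<close> at all n + 1 places contribute together \<open>a\<close>
  times the term of that word.\<close>

lemma Worpitzky_permutations:
  fixes a :: "'a::field_char_0"
  shows "(\<Sum>xs\<in>permutations_of_set {1..n}. (a + of_nat (descents xs)) gchoose n) = a ^ n"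
proof (induction n)
  case (Suc n)
  have "(\<Sum>xs\<in>permutations_of_set {1..Suc n}. (a + of_nat (descents xs)) gchoose Suc n) =
        (\<Sum>xs\<in>permutations_of_set {1..n}. \<Sum>p = 0..n.
           (a + of_nat (descents (insert_at p (Suc n) xs))) gchoose Suc n)"
    using sum.reindex_bij_betw[OF bij_betw_insert_at_permutations[of "{1..n}" "Suc n"],
        of "\<lambda>xs. (a + of_nat (descents xs)) gchoose Suc n"]
    by (simp add: sum.cartesian_product case_prod_beta atLeastAtMostSuc_conv)
  also have "\<dots> = (\<Sum>xs\<in>permutations_of_set {1..n}. a * ((a + of_nat (descents xs)) gchoose n))"
  proof (rule sum.cong)
    fix xs assume "xs \<in> permutations_of_set {1..n}"
    then have "\<forall>y\<in>set xs. y < Suc n" "length xs = n"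
      by (auto simp: permutations_of_set_def dest: distinct_card)
    then show "(\<Sum>p = 0..n. (a + of_nat (descents (insert_at p (Suc n) xs))) gchoose Suc n) =
               a * ((a + of_nat (descents xs)) gchoose n)"
      using sum_descents_insert_max[of xs "Suc n" "\<lambda>d. (a + of_nat d) gchoose Suc n"]
      by (simp only: gchoose_Worpitzky_step)
  qed simp
  also have "\<dots> = a ^ Suc n"
    by (simp only: sum_distrib_left[symmetric] Suc power_Suc)
  finally show ?case .
qed auto

text \<open>One-line notation, with list positions shifted by one against the arguments 1..n. A
  permutation is the identity outside \<open>{1..n}\<close>, so its word determines it.\<close>

lemma eulerian_conv_descents:
  "eulerian n k = card {xs \<in> permutations_of_set {1..n}. descents xs = k}"
proof -
  let ?f = "\<lambda>\<pi>. map \<pi> [1..<Suc n]"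
  let ?g = "\<lambda>xs i. if i \<in> {1..n} then xs ! (i - 1) else i"
  have "bij_betw ?f {\<pi>. \<pi> permutes {1..n} \<and> card {i\<in>{1..<n}. \<pi> i > \<pi> (Suc i)} = k}
          {xs \<in> permutations_of_set {1..n}. descents xs = k}"
  proof (rule bij_betwI[where g = ?g])
    have desc: "descents (?f \<pi>) = card {i\<in>{1..<n}. \<pi> i > \<pi> (Suc i)}" for \<pi> :: "nat \<Rightarrow> nat"
    proof -
      have "bij_betw Suc {i. Suc i < length (?f \<pi>) \<and> ?f \<pi> ! i > ?f \<pi> ! Suc i}
              {i\<in>{1..<n}. \<pi> i > \<pi> (Suc i)}"
        by (rule bij_betwI[where g = "\<lambda>i. i - 1"]) (auto simp: nth_append simp del: upt_Suc)
      then show ?thesis unfolding descents_conv_card by (rule bij_betw_same_card)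
    qed
    show "?f \<in> {\<pi>. \<pi> permutes {1..n} \<and> card {i\<in>{1..<n}. \<pi> i > \<pi> (Suc i)} = k} \<rightarrow>
            {xs \<in> permutations_of_set {1..n}. descents xs = k}"
      unfolding desc[symmetric]
      by (auto simp: permutations_of_set_def distinct_map permutes_inj_on permutes_image
            atLeastLessThanSuc_atLeastAtMost simp del: upt_Suc)
    have map_g: "?f (?g xs) = xs" if "xs \<in> permutations_of_set {1..n}" for xs
      using that by (intro nth_equalityI)
        (auto simp: permutations_of_set_def dest!: distinct_card simp del: upt_Suc)
    show "?f (?g xs) = xs" if "xs \<in> {xs \<in> permutations_of_set {1..n}. descents xs = k}" for xs
      using that map_g by blast
    show "?g (?f \<pi>) = \<pi>"
      if "\<pi> \<in> {\<pi>. \<pi> permutes {1..n} \<and> card {i\<in>{1..<n}. \<pi> i > \<pi> (Suc i)} = k}" for \<pi>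
    proof
      fix i
      have "\<pi> i = i" if "i \<notin> {1..n}"
        using that \<open>\<pi> \<in> _\<close> by (auto dest: permutes_not_in)
      then show "?g (?f \<pi>) i = \<pi> i" by (auto simp del: upt_Suc)
    qed
    show "?g \<in> {xs \<in> permutations_of_set {1..n}. descents xs = k} \<rightarrow>
            {\<pi>. \<pi> permutes {1..n} \<and> card {i\<in>{1..<n}. \<pi> i > \<pi> (Suc i)} = k}"
    proof safe
      fix xs assume xs: "xs \<in> permutations_of_set {1..n}"
      have len: "length xs = n" and "distinct xs" and set: "set xs = {1..n}"
        using xs by (auto simp: permutations_of_set_def dest: distinct_card)
      have "bij_betw (?g xs) {1..n} {1..n}"
      proof -
        have "bij_betw (\<lambda>i. xs ! (i - 1)) {1..n} {1..n}"
        proof -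
          have "bij_betw (\<lambda>i. i - 1) {1..n} {..<n}"
            by (rule bij_betwI[where g = Suc]) auto
          moreover have "bij_betw ((!) xs) {..<n} {1..n}"
            using \<open>distinct xs\<close> len set by (intro bij_betw_nth) auto
          ultimately show ?thesis
            using bij_betw_trans by (fastforce simp: comp_def)
        qed
        then show ?thesis
          by (subst bij_betw_cong[where g = "\<lambda>i. xs ! (i - 1)"]) auto
      qed
      then show "?g xs permutes {1..n}"
        by (rule bij_imp_permutes) auto
      show "card {i\<in>{1..<n}. ?g xs i > ?g xs (Suc i)} = descents xs"
        using desc[of "?g xs"] unfolding map_g[OF xs] by (rule sym)
    qed
  qed
  then show ?thesis unfolding eulerian_def by (rule bij_betw_same_card)
qed

lemma Worpitzky:
  fixes a :: "'a::field_char_0"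
  assumes "n \<ge> 1"
  shows "(\<Sum>k = 0..n - 1. of_nat (eulerian n k) * ((a + of_nat k) gchoose n)) = a ^ n"
proof -
  have "a ^ n = (\<Sum>xs\<in>permutations_of_set {1..n}. (a + of_nat (descents xs)) gchoose n)"
    by (simp only: Worpitzky_permutations)
  also have "\<dots> = (\<Sum>k\<in>{0..n-1}. \<Sum>xs\<in>{xs \<in> permutations_of_set {1..n}. descents xs = k}.
       (a + of_nat (descents xs)) gchoose n)"
  proof (rule sum.group[symmetric])
    show "descents ` permutations_of_set {1..n} \<subseteq> {0..n-1}"
    proof safe
      fix xs :: "nat list" assume "xs \<in> permutations_of_set {1..n}"
      then have "length xs = n" by (auto simp: permutations_of_set_def dest: distinct_card)
      with descents_less_length[of xs] assms show "descents xs \<in> {0..n-1}" by (cases "xs = []") auto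
    qed
  qed auto
  also have "\<dots> = (\<Sum>k = 0..n - 1. of_nat (eulerian n k) * ((a + of_nat k) gchoose n))"
    by (simp add: eulerian_conv_descents)
  finally show ?thesis ..
qed

section \<open>Set partitions under insertion of an element\<close>

text \<open>This is the mechanism of S(n+1, k) = S(n, k-1) + k S(n, k), stated for an arbitrary
  weight \<open>g\<close> of the number of blocks so that falling factorials can be
  substituted.\<close>

lemma sum_partitions_insert:
  fixes g :: "nat \<Rightarrow> 'b::comm_ring_1"
  assumes "finite A" "x \<notin> A"
  shows "(\<Sum>P | partition_on (insert x A) P. g (card P)) =
         (\<Sum>P | partition_on A P. g (card P + 1) + of_nat (card P) * g (card P))"
proof -
  \<comment> \<open>\<open>x\<close> joins the block \<open>p\<close>; the choice \<open>p = {}\<close> encodes a new block.\<close>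
  let ?h = "\<lambda>(P, p). insert (insert x p) (P - {p})"
  let ?i = "\<lambda>P. ((\<lambda>b. b - {x}) ` P - {{}}, \<Union>{b\<in>P. x \<in> b} - {x})"
  let ?c = "\<lambda>(P, p). if p = {} then card P + 1 else card P"
  have fin: "finite P" if "partition_on A P" for P
    using that assms(1) finite_elements by blast
  have "(\<Sum>P | partition_on (insert x A) P. g (card P)) =
        (\<Sum>z\<in>Sigma {P. partition_on A P} (insert {}). g (?c z))"
  proof (rule sum.reindex_bij_witness[of _ ?h ?i])
    fix P assume "P \<in> {P. partition_on (insert x A) P}"
    then have P: "partition_on (insert x A) P" by simp
    then obtain b where b: "b \<in> P" "x \<in> b" by (auto simp: partition_on_def)
    have uniq: "c = b" if "c \<in> P" "x \<in> c" for c
      using that b P by (auto simp: partition_on_def disjoint_def)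
    have Ub: "\<Union>{b\<in>P. x \<in> b} = b" using b uniq by blast
    have noc: "c - {x} = c" if "c \<in> P - {b}" for c
      using that uniq by auto
    have im: "(\<lambda>b. b - {x}) ` P = insert (b - {x}) (P - {b})"
      using noc b(1) by (auto simp: image_iff) (metis Diff_iff singletonD)+
    have ne: "{} \<notin> P" using P by (simp add: partition_on_def)
    have disj: "c \<inter> b = {}" if "c \<in> P - {b}" for c
      using that b P by (auto simp: partition_on_def disjoint_def)
    \<comment> \<open>If \<open>b - {x}\<close> were also another block, taking it out in
      \<open>?h\<close> would lose that block, and the block count \<open>?c\<close> would be
      wrong.\<close>
    have bx: "b - {x} \<notin> P - {b}"
    proof
      assume bx: "b - {x} \<in> P - {b}"
      then have "b - {x} = {}" using disj[OF bx] by blast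
      with bx ne show False by (metis DiffD1)
    qed
    show "?h (?i P) = P"
      unfolding Ub im using bx b ne by (auto simp: insert_absorb)
    have P': "partition_on A (insert (b - {x}) (P - {b}) - {{}})"
    proof (rule partition_onI)
      show "\<Union>(insert (b - {x}) (P - {b}) - {{}}) = A"
      proof -
        have "\<Union>(insert (b - {x}) (P - {b}) - {{}}) = \<Union>P - {x}"
        proof -
          have "\<Union>P = b \<union> \<Union>(P - {b})" using b(1) by auto
          moreover have "x \<notin> \<Union>(P - {b})" using uniq by auto
          ultimately show ?thesis by auto
        qed
        then show ?thesis using partition_onD1[OF P] assms(2) by (metis Diff_insert_absorb)
      qed
      show "disjnt p q" if "p \<in> insert (b - {x}) (P - {b}) - {{}}" "q \<in> insert (b - {x}) (P - {b}) - {{}}" "p \<noteq> q" for p q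
      proof -
        have 1: "disjnt p q" if "p \<in> P - {b}" "q \<in> P - {b}" "p \<noteq> q" for p q
          using that P by (auto simp: partition_on_def disjoint_def disjnt_def)
        have 2: "disjnt (b - {x}) q" "disjnt q (b - {x})" if "q \<in> P - {b}" for q
          using disj[OF that] by (auto simp: disjnt_def)
        show ?thesis using that(3) DiffD1[OF that(1)] DiffD1[OF that(2)] 1 2 by (elim insertE) simp_all
      qed
    qed auto
    show "?i P \<in> Sigma {P. partition_on A P} (insert {})"
      unfolding Ub im using P' by simp
    have "finite P" using P assms(1) finite_elements by blast
    then have "card P = Suc (card (P - {b}))" using b(1) by (metis card_Suc_Diff1)
    with \<open>finite P\<close> bx ne have "?c (?i P) = card P"
      unfolding Ub im by (auto simp: insert_Diff_if)
    then show "g (?c (?i P)) = g (card P)" by simp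
  next
    fix z assume z: "z \<in> Sigma {P. partition_on A P} (insert {})"
    obtain P p where zp: "z = (P, p)" by (cases z)
    from z have P: "partition_on A P" and p: "p = {} \<or> p \<in> P" by (auto simp: zp)
    have ne: "{} \<notin> P" using P by (simp add: partition_on_def)
    have x: "x \<notin> c" if "c \<in> P" for c using that P assms by (auto simp: partition_on_def)
    have xp: "x \<notin> p" using p x by auto
    have noc: "c - {x} = c" if "c \<in> P" for c
      using that x by auto
    have im: "(\<lambda>b. b - {x}) ` (P - {p}) = P - {p}"
      using noc by (auto simp: image_iff)
    have "(\<lambda>b. b - {x}) ` (insert (insert x p) (P - {p})) - {{}} = P"
      unfolding image_insert im using xp p ne by auto
    moreover have "\<Union>{b \<in> insert (insert x p) (P - {p}). x \<in> b} = insert x p"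
      using x by auto
    ultimately show "?i (?h z) = z"
      using xp by (simp add: zp)
    show "?h z \<in> {P. partition_on (insert x A) P}"
    proof -
      have "partition_on (insert x A) (insert (insert x p) (P - {p}))"
      proof (rule partition_onI)
        show "\<Union>(insert (insert x p) (P - {p})) = insert x A"
        proof -
          have "p \<union> \<Union>(P - {p}) = \<Union>P" using p by auto
          then show ?thesis using partition_onD1[OF P] by simp
        qed
        show "{} \<notin> insert (insert x p) (P - {p})" using ne by simp
        show "disjnt a b" if "a \<in> insert (insert x p) (P - {p})" "b \<in> insert (insert x p) (P - {p})" "a \<noteq> b" for a b
        proof -
          have 1: "disjnt a b" if "a \<in> P" "b \<in> P" "a \<noteq> b" for a b
            using that P by (auto simp: partition_on_def disjoint_def disjnt_def)
          have 2: "disjnt (insert x p) b" "disjnt b (insert x p)" if "b \<in> P - {p}" for b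
          proof -
            have "p \<inter> b = {}" using 1[of p b] that p by (cases "p = {}") (auto simp: disjnt_def)
            moreover have "x \<notin> b" using that x by blast
            ultimately show "disjnt (insert x p) b" "disjnt b (insert x p)"
              by (simp_all add: disjnt_def Int_commute)
          qed
          show ?thesis using that 1 2 by (metis DiffD1 insertE)
        qed
      qed
      then show ?thesis by (simp add: zp)
    qed
  qed
  also have "\<dots> = (\<Sum>P | partition_on A P. \<Sum>p\<in>insert {} P. g (?c (P, p)))"
    using assms fin finitely_many_partition_on[OF assms(1)]
    by (subst sum.Sigma) (auto intro!: sum.cong)
  also have "\<dots> = (\<Sum>P | partition_on A P. g (card P + 1) + of_nat (card P) * g (card P))"
  proof (rule sum.cong)
    fix P assume "P \<in> {P. partition_on A P}"
    then have "finite P" "{} \<notin> P" using fin by (auto simp: partition_on_def)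
    moreover from this have "(\<Sum>p\<in>P. g (?c (P, p))) = (\<Sum>p\<in>P. g (card P))"
      by (intro sum.cong) auto
    ultimately show "(\<Sum>p\<in>insert {} P. g (?c (P, p))) = g (card P + 1) + of_nat (card P) * g (card P)"
      by simp
  qed simp
  finally show ?thesis .
qed

text \<open>For natural \<open>a\<close> this counts the maps from \<open>A\<close> to an
  \<open>a\<close>-element set by their partition into fibres. The weight is the falling factorial
  (a)_k, and the induction uses (a)_(k+1) + k (a)_k = a (a)_k, which holds for every field
  element.\<close>

lemma power_eq_sum_partitions:
  fixes a :: "'a::field_char_0"
  assumes "finite A"
  shows "(\<Sum>P | partition_on A P. (a gchoose card P) * fact (card P)) = a ^ card A"
  using assms
proof (induction A rule: finite_induct)
  case empty
  have "{P. partition_on {} P} = {{}}" by (auto simp: partition_on_empty)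
  then show ?case by (simp del: Collect_const add: partition_on_empty)
next
  case (insert x A)
  have step: "(a gchoose (k + 1)) * fact (k + 1) + of_nat k * ((a gchoose k) * fact k) =
      a * ((a gchoose k) * fact k)" for k
  proof -
    have "(a gchoose (k + 1)) * fact (k + 1) + of_nat k * ((a gchoose k) * fact k) =
        fact k * (of_nat k * (a gchoose k) + of_nat (Suc k) * (a gchoose (Suc k)))"
      by (simp add: algebra_simps)
    then show ?thesis by (simp only: gbinomial_mult_1[symmetric] mult_ac)
  qed
  show ?case
    using sum_partitions_insert[OF insert.hyps, of "\<lambda>k. (a gchoose k) * fact k"] insert
    by (simp only: step sum_distrib_left[symmetric]) simp
qed

lemma power_eq_sum_stirling2:
  fixes a :: "'a::field_char_0"
  assumes "n \<ge> 1"
  shows "(\<Sum>k = 1..n. of_nat (stirling2 n k) * (a gchoose k) * fact k) = a ^ n"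
proof -
  have "a ^ n = (\<Sum>P | partition_on {1..n} P. (a gchoose card P) * fact (card P))"
    by (simp add: power_eq_sum_partitions)
  also have "\<dots> = (\<Sum>k\<in>{1..n}. \<Sum>P\<in>{P \<in> {P. partition_on {1..n} P}. card P = k}. (a gchoose card P) * fact (card P))"
  proof (rule sum.group[symmetric])
    show "card ` {P. partition_on {1..n} P} \<subseteq> {1..n}"
    proof safe
      fix P assume P: "partition_on {1..n} P"
      then have "P \<noteq> {}" "finite P" using assms finite_elements[OF _ P] by (auto simp: partition_on_def)
      moreover have "card P \<le> card {1..n}"
      proof (rule card_le_if_inj_on_rel[where r = "\<lambda>p i. i \<in> p"])
        show "\<exists>b. b \<in> {1..n} \<and> b \<in> a" if "a \<in> P" for a
          using that P by (auto simp: partition_on_def) (metis UnionI all_not_in_conv atLeastAtMost_iff)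
        show "a1 = a2" if "a1 \<in> P" "a2 \<in> P" "b \<in> {1..n}" "b \<in> a1" "b \<in> a2" for a1 a2 b
          using that P by (auto simp: partition_on_def disjoint_def)
      qed simp
      ultimately show "card P \<in> {1..n}" by (simp add: Suc_le_eq card_gt_0_iff)
    qed
  qed (auto simp: finitely_many_partition_on)
  also have "\<dots> = (\<Sum>k = 1..n. of_nat (stirling2 n k) * (a gchoose k) * fact k)"
    by (simp add: stirling2_def mult.assoc)
  finally show ?thesis ..
qed

section \<open>Horizontal strips and Kostka numbers\<close>

text \<open>A partition as its row lengths padded with zeros: interlacing, truncation and adding a
  box become pointwise operations on functions.\<close>

definition shape :: "(nat \<Rightarrow> nat) \<Rightarrow> bool" where
  "shape r \<longleftrightarrow> antimono r \<and> (\<exists>N. r N = 0)"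

text \<open>By the convention for infinite sums the weight is \<open>0\<close> if \<open>r\<close> has infinite support.\<close>

definition weight :: "(nat \<Rightarrow> nat) \<Rightarrow> nat" where
  "weight r = sum r {i. r i \<noteq> 0}"

text \<open>
  Interlacing with \<open>l\<close> means that \<open>l / \<nu>\<close> is a horizontal strip; it forces both
  sequences to be antitone.
\<close>

definition strips :: "(nat \<Rightarrow> nat) \<Rightarrow> (nat \<Rightarrow> nat) set" where
  "strips l = {\<nu>. \<forall>i. \<nu> i \<le> l i \<and> l (Suc i) \<le> \<nu> i}"

definition hstrip :: "nat \<Rightarrow> (nat \<Rightarrow> nat) \<Rightarrow> (nat \<Rightarrow> nat) set" where
  "hstrip a l = {\<nu> \<in> strips l. weight l = weight \<nu> + a}"

lemma shape_antimonoD: "shape r \<Longrightarrow> i \<le> j \<Longrightarrow> r j \<le> r i"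
  by (auto simp: shape_def antimono_def)

lemma shape_eventually_0:
  assumes "shape r" obtains N where "\<And>i. i \<ge> N \<Longrightarrow> r i = 0"
  using assms shape_antimonoD[OF assms] by (metis shape_def le_zero_eq)

lemma weight_eq_sum: "(\<And>i. i \<ge> N \<Longrightarrow> r i = 0) \<Longrightarrow> weight r = sum r {..<N}"
  unfolding weight_def by (rule sum.mono_neutral_left) (use not_less in blast)+

lemma strips_le: "\<nu> \<in> strips l \<Longrightarrow> \<nu> i \<le> l i"
  and strips_ge: "\<nu> \<in> strips l \<Longrightarrow> l (Suc i) \<le> \<nu> i"
  by (auto simp: strips_def)

lemma strips_shape:
  assumes "\<nu> \<in> strips l"
  shows "shape \<nu> \<longleftrightarrow> shape l"
proof -
  have "\<nu> (Suc i) \<le> \<nu> i" "l (Suc i) \<le> l i" for i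
    using strips_le[OF assms, of "Suc i"] strips_ge[OF assms, of i] strips_le[OF assms, of i]
    by simp_all
  then have "antimono \<nu>" "antimono l" by (simp_all add: decseq_Suc_iff)
  moreover have "\<nu> N = 0" if "l N = 0" for N using strips_le[OF assms, of N] that by simp
  moreover have "l (Suc N) = 0" if "\<nu> N = 0" for N using strips_ge[OF assms, of N] that by simp
  ultimately show ?thesis unfolding shape_def by blast
qed

lemma finite_strips: assumes "shape l" shows "finite (strips l)"
proof -
  obtain N where N: "\<And>i. i \<ge> N \<Longrightarrow> l i = 0" using assms shape_eventually_0 by blast
  have "strips l \<subseteq> {f. \<forall>x. (x \<in> {..<N} \<longrightarrow> f x \<in> {..l 0}) \<and> (x \<notin> {..<N} \<longrightarrow> f x = 0)}"
  proof (rule subsetI, simp, intro allI conjI impI)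
    fix f i assume f: "f \<in> strips l"
    show "f i \<le> l 0" using strips_le[OF f, of i] shape_antimonoD[OF assms, of 0 i] by simp
    show "f i = 0" if "\<not> i < N" using strips_le[OF f, of i] N[of i] that by simp
  qed
  moreover have "finite \<dots>" by (rule finite_set_of_finite_funs) auto
  ultimately show ?thesis by (rule finite_subset)
qed

lemma finite_hstrip: "shape l \<Longrightarrow> finite (hstrip a l)"
  unfolding hstrip_def by (simp add: finite_strips)

lemma weight_mono_eq:
  assumes "shape l" "\<And>i. \<nu> i \<le> l i"
  shows "weight \<nu> \<le> weight l" "weight \<nu> = weight l \<Longrightarrow> \<nu> = l"
proof -
  obtain N where N: "\<And>i. i \<ge> N \<Longrightarrow> l i = 0" using assms(1) shape_eventually_0 by blast
  have N': "\<nu> i = 0" if "i \<ge> N" for i using N[OF that] assms(2)[of i] by simp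
  have w: "weight \<nu> = sum \<nu> {..<N}" "weight l = sum l {..<N}"
    using N N' weight_eq_sum by blast+
  show "weight \<nu> \<le> weight l" unfolding w by (rule sum_mono) (rule assms)
  assume "weight \<nu> = weight l"
  then have "\<nu> i = l i" if "i < N" for i
    using sum_mono_inv[of \<nu> "{..<N}" l i] assms(2) that unfolding w by simp
  with N N' show "\<nu> = l" by (metis ext not_less)
qed

lemma hstrip_0: assumes "shape l" shows "hstrip 0 l = {l}"
proof -
  have "l \<in> strips l" using assms by (auto simp: strips_def intro: shape_antimonoD)
  then show ?thesis
    using weight_mono_eq(2)[OF assms, of \<nu> for \<nu>] by (auto simp: hstrip_def strips_le)
qed

lemma weight_add_box:
  assumes "shape r"
  shows "weight (r(i := Suc (r i))) = Suc (weight r)"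
proof -
  obtain N where N: "\<And>i. i \<ge> N \<Longrightarrow> r i = 0" using assms shape_eventually_0 by blast
  have "weight (r(i := Suc (r i))) = sum (r(i := Suc (r i))) {..<max N (Suc i)}"
    by (rule weight_eq_sum) (use N in auto)
  also have "\<dots> = Suc (sum r {..<max N (Suc i)})"
    by (simp add: sum.remove[of "{..<max N (Suc i)}" i])
  also have "sum r {..<max N (Suc i)} = weight r"
    by (rule weight_eq_sum[symmetric]) (use N in auto)
  finally show ?thesis .
qed

lemma add_box_obtain:
  assumes "shape l" "shape \<nu>" "\<And>i. \<nu> i \<le> l i" "weight l = Suc (weight \<nu>)"
  obtains i where "l = \<nu>(i := Suc (\<nu> i))"
proof -
  obtain i where i: "\<nu> i < l i" using assms(3,4) by (metis ext le_neq_implies_less n_not_Suc_n)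
  have "\<nu>(i := Suc (\<nu> i)) = l"
    by (rule weight_mono_eq(2)[OF assms(1)])
      (use i assms weight_add_box[OF assms(2), of i] in auto)
  then show ?thesis using that by blast
qed

section \<open>Strip removal operators and their commutation\<close>

text \<open>The operator U_a, acting on functions of sequences. The value 0 off shapes lets the laws
  below hold as equations between functions.\<close>

definition remove_strip :: "nat \<Rightarrow> ((nat \<Rightarrow> nat) \<Rightarrow> nat) \<Rightarrow> (nat \<Rightarrow> nat) \<Rightarrow> nat" where
  "remove_strip a F l = (if shape l then \<Sum>\<nu>\<in>hstrip a l. F \<nu> else 0)"

lemma remove_strip_commute:
  "remove_strip a (remove_strip b F) = remove_strip b (remove_strip a F)"
proof
  fix l
  show "remove_strip a (remove_strip b F) l = remove_strip b (remove_strip a F) l"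
  proof (cases "shape l")
    case shape: True
    have shape': "shape \<nu>" if "\<nu> \<in> hstrip c l" for \<nu> c
      using that shape strips_shape by (auto simp: hstrip_def)
    have expand: "remove_strip a (remove_strip b F) l =
        (\<Sum>(\<nu>, \<rho>)\<in>Sigma (hstrip a l) (hstrip b). F \<rho>)" for a b
      using shape shape' by (simp add: remove_strip_def sum.Sigma finite_hstrip)
    \<comment> \<open>The Bender-Knuth involution on Gelfand-Tsetlin patterns: reflect each \<open>\<nu> i\<close> in the
      interval that interlacing with \<open>l\<close> and \<open>\<rho>\<close> allows for it.\<close>
    define bk where "bk = (\<lambda>(\<nu>, \<rho>).
      (\<lambda>i. max (\<rho> i) (l (Suc i)) + (case i of 0 \<Rightarrow> l 0 | Suc j \<Rightarrow> min (l i) (\<rho> j)) - \<nu> i, \<rho> :: nat \<Rightarrow> nat))"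
    have bk: "bk z \<in> Sigma (hstrip b l) (hstrip a) \<and> bk (bk z) = z"
      if z: "z \<in> Sigma (hstrip a l) (hstrip b)" for z a b
    proof -
      obtain \<nu> \<rho> where z_eq: "z = (\<nu>, \<rho>)" by (cases z)
      have \<nu>: "\<nu> \<in> strips l" "weight l = weight \<nu> + a" and \<rho>: "\<rho> \<in> strips \<nu>" "weight \<nu> = weight \<rho> + b"
        using z by (auto simp: z_eq hstrip_def)
      define lo where "lo = (\<lambda>i. max (\<rho> i) (l (Suc i)))"
      define hi where "hi = (\<lambda>i. case i of 0 \<Rightarrow> l 0 | Suc j \<Rightarrow> min (l i) (\<rho> j))"
      define \<nu>' where "\<nu>' = (\<lambda>i. lo i + hi i - \<nu> i)"
      have lo: "lo i \<le> \<nu> i" and hi: "\<nu> i \<le> hi i" for i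
        using strips_le[OF \<nu>(1)] strips_ge[OF \<nu>(1)] strips_le[OF \<rho>(1)] strips_ge[OF \<rho>(1)]
        by (auto simp: lo_def hi_def split: nat.splits)
      have lo': "lo i \<le> \<nu>' i" and hi': "\<nu>' i \<le> hi i" and inv: "lo i + hi i - \<nu>' i = \<nu> i"
        and sum: "\<nu>' i + \<nu> i = lo i + hi i" for i
        using lo[of i] hi[of i] by (auto simp: \<nu>'_def)
      have bk_z: "bk z = (\<nu>', \<rho>)" by (simp add: bk_def z_eq \<nu>'_def lo_def hi_def)
      have "bk (bk z) = z"
        unfolding bk_z using inv by (simp add: bk_def z_eq lo_def hi_def)
      have "hi i \<le> l i" for i by (auto simp: hi_def split: nat.splits)
      then have 1: "\<nu>' \<in> strips l"
        using lo' hi' by (auto simp: strips_def lo_def intro: order_trans max.boundedI le_trans)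
      have "hi (Suc i) \<le> \<rho> i" for i by (simp add: hi_def)
      then have 2: "\<rho> \<in> strips \<nu>'"
        using lo' hi' by (auto simp: strips_def lo_def intro: order_trans)
      obtain N where N: "\<And>i. i \<ge> N \<Longrightarrow> l i = 0" using shape shape_eventually_0 by blast
      have N': "\<nu> i = 0" "\<nu>' i = 0" "\<rho> i = 0" if "i \<ge> N" for i
        using N[OF that] strips_le[OF \<nu>(1), of i] strips_le[OF 1, of i] strips_le[OF \<rho>(1), of i] by simp_all
      have w: "weight r = sum r {..<Suc N}" if "r \<in> {l, \<nu>, \<nu>', \<rho>}" for r
        using that N N' by (auto intro!: weight_eq_sum)
      have "weight \<nu>' + weight \<nu> = (\<Sum>i<Suc N. lo i) + (\<Sum>i<Suc N. hi i)"
        using sum by (simp only: w insert_iff simp_thms sum.distrib[symmetric])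
      also have "(\<Sum>i<Suc N. hi i) = l 0 + (\<Sum>i<N. min (l (Suc i)) (\<rho> i))"
        by (subst sum.lessThan_Suc_shift) (simp add: hi_def)
      also have "(\<Sum>i<Suc N. lo i) = (\<Sum>i<N. max (\<rho> i) (l (Suc i)))"
        using N N' by (simp add: lo_def)
      finally have "weight \<nu>' + weight \<nu> = l 0 + ((\<Sum>i<N. max (\<rho> i) (l (Suc i)) + min (l (Suc i)) (\<rho> i)))"
        by (simp add: sum.distrib)
      \<comment> \<open>The lower bound of row \<open>i\<close> and the upper bound of row
        \<open>i + 1\<close> are the maximum and minimum of the same two numbers. Hence all bounds
        together sum to \<open>weight \<rho> + weight l\<close>, and the reflection exchanges the
        two strip sizes.\<close>
      also have "(\<Sum>i<N. max (\<rho> i) (l (Suc i)) + min (l (Suc i)) (\<rho> i)) = (\<Sum>i<N. \<rho> i + l (Suc i))"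
        by (rule sum.cong) (auto simp: max_def min_def)
      also have "l 0 + (\<Sum>i<N. \<rho> i + l (Suc i)) = weight \<rho> + weight l"
        using w[of l] w[of \<rho>] N' sum.lessThan_Suc_shift[of l N] by (simp add: sum.distrib)
      finally have "weight l = weight \<nu>' + b" "weight \<nu>' = weight \<rho> + a"
        using \<nu>(2) \<rho>(2) by linarith+
      with 1 2 \<open>bk (bk z) = z\<close> show ?thesis by (simp add: bk_z hstrip_def)
    qed
    have snd_bk: "snd (bk z) = snd z" for z by (simp add: bk_def case_prod_beta)
    show ?thesis unfolding expand
    proof (rule sum.reindex_bij_witness[of _ bk bk])
      show "bk (bk z) = z" "bk z \<in> Sigma (hstrip b l) (hstrip a)"
        if "z \<in> Sigma (hstrip a l) (hstrip b)" for z using bk[OF that] by blast+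
      show "bk (bk z) = z" "bk z \<in> Sigma (hstrip a l) (hstrip b)"
        if "z \<in> Sigma (hstrip b l) (hstrip a)" for z using bk[OF that] by blast+
    qed (simp add: case_prod_beta snd_bk)
  qed (simp add: remove_strip_def)
qed

lemma remove_strip_0:
  assumes "\<And>l. \<not> shape l \<Longrightarrow> F l = 0"
  shows "remove_strip 0 F = F"
proof
  show "remove_strip 0 F l = F l" for l
    by (cases "shape l") (simp_all add: remove_strip_def hstrip_0 assms)
qed

section \<open>Kostka numbers\<close>

text \<open>The number of semistandard tableaux of shape \<open>l\<close> with \<open>c i\<close>
  entries \<open>i\<close> for each \<open>i < m\<close>, by peeling off the letter
  \<open>m - 1\<close>. The content \<open>c\<close> is read only below \<open>m\<close>.\<close>

primrec kostka :: "(nat \<Rightarrow> nat) \<Rightarrow> nat \<Rightarrow> (nat \<Rightarrow> nat) \<Rightarrow> nat" where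
  "kostka c 0 = (\<lambda>l. of_bool (l = (\<lambda>_. 0)))"
| "kostka c (Suc m) = remove_strip (c m) (kostka c m)"

lemma shape_0 [simp]: "shape (\<lambda>_. 0)"
  by (auto simp: shape_def antimono_def)

lemma kostka_eq_0: "\<not> shape l \<Longrightarrow> kostka c m l = 0"
  by (cases m) (auto simp: remove_strip_def)

lemma kostka_cong: "(\<And>i. i < m \<Longrightarrow> c i = d i) \<Longrightarrow> kostka c m = kostka d m"
proof (induction m)
  case (Suc m)
  then have "kostka c m = kostka d m" "c m = d m" by (metis less_SucI lessI)+
  then show ?case by simp
qed simp

text \<open>A letter that does not occur acts as \<open>remove_strip 0\<close>, the identity on
  functions vanishing off shapes. What remains are the nonzero multiplicities, the data that
  \<open>exponents\<close> records.\<close>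

lemma fold_remove_strip_filter:
  assumes "\<And>l. \<not> shape l \<Longrightarrow> F l = 0"
  shows "fold remove_strip (filter (\<lambda>a. a \<noteq> 0) as) F = fold remove_strip as F"
  using assms
proof (induction as arbitrary: F)
  case (Cons a as)
  show ?case
  proof (cases "a = 0")
    case True
    then show ?thesis using Cons.IH[OF Cons.prems] remove_strip_0[OF Cons.prems] by simp
  next
    case False
    have "remove_strip a F l = 0" if "\<not> shape l" for l using that by (simp add: remove_strip_def)
    from Cons.IH[OF this] False show ?thesis by simp
  qed
qed simp

lemma kostka_conv_fold:
  "kostka c m = fold remove_strip (filter (\<lambda>a. a \<noteq> 0) (map c [0..<m])) (kostka c 0)"
proof -
  have "kostka c m = fold remove_strip (map c [0..<m]) (kostka c 0)"
    by (induction m) simp_all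
  then show ?thesis by (subst fold_remove_strip_filter) (auto simp: kostka_eq_0 simp del: kostka.simps)
qed

lemma kostka_symmetric:
  assumes "filter_mset (\<lambda>a. a \<noteq> 0) (image_mset c (mset_set {..<m})) =
           filter_mset (\<lambda>a. a \<noteq> 0) (image_mset d (mset_set {..<k}))"
  shows "kostka c m = kostka d k"
proof -
  have "mset (filter (\<lambda>a. a \<noteq> 0) (map c [0..<m])) = mset (filter (\<lambda>a. a \<noteq> 0) (map d [0..<k]))"
    using assms by (simp add: mset_filter lessThan_atLeast0)
  moreover have "remove_strip a \<circ> remove_strip b = remove_strip b \<circ> remove_strip a" for a b
    using remove_strip_commute by (simp add: fun_eq_iff)
  ultimately have "fold remove_strip (filter (\<lambda>a. a \<noteq> 0) (map c [0..<m])) =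
      fold remove_strip (filter (\<lambda>a. a \<noteq> 0) (map d [0..<k]))"
    by (intro fold_multiset_equiv) auto
  then show ?thesis by (subst (1 2) kostka_conv_fold) simp
qed

text \<open>In a tableau with strictly increasing columns the letters below \<open>k\<close> lie in
  the first \<open>k\<close> rows, which is the dominance inequality. In the induction prefix sums
  only grow when a strip is added.\<close>

lemma kostka_nonzeroD:
  assumes "kostka c m l \<noteq> 0"
  shows "shape l" "weight l = sum c {..<m}" "i \<ge> m \<Longrightarrow> l i = 0"
    "k \<le> m \<Longrightarrow> sum c {..<k} \<le> sum l {..<k}"
proof -
  show "shape l" using assms kostka_eq_0[of l c m] by auto
  have "weight l = sum c {..<m} \<and> (\<forall>i\<ge>m. l i = 0) \<and> (\<forall>k\<le>m. sum c {..<k} \<le> sum l {..<k})"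
    using assms
  proof (induction m arbitrary: l)
    case 0
    then show ?case by (auto simp: weight_def split: if_splits)
  next
    case (Suc m)
    from Suc.prems have l: "shape l" using kostka_eq_0[of l c "Suc m"] by auto
    with Suc.prems have "sum (kostka c m) (hstrip (c m) l) \<noteq> 0"
      by (simp add: remove_strip_def del: sum_eq_0_iff)
    then obtain \<nu> where \<nu>: "\<nu> \<in> hstrip (c m) l" "kostka c m \<nu> \<noteq> 0"
      by (rule sum.not_neutral_contains_not_neutral)
    note IH = Suc.IH[OF \<nu>(2)]
    have strip: "\<nu> \<in> strips l" and w: "weight l = weight \<nu> + c m" using \<nu>(1) by (auto simp: hstrip_def)
    have 0: "l i = 0" if "i \<ge> Suc m" for i
      using that IH strips_ge[OF strip, of "i - 1"] by (cases i) auto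
    have "sum c {..<k} \<le> sum l {..<k}" if "k \<le> m" for k
    proof -
      have "sum \<nu> {..<k} \<le> sum l {..<k}" by (rule sum_mono) (rule strips_le[OF strip])
      with IH that show ?thesis using order_trans by blast
    qed
    \<comment> \<open>The new prefix length is handled by weight: no rows lie beyond it, so equality
      holds there.\<close>
    moreover have "sum c {..<Suc m} = sum l {..<Suc m}"
      using IH w weight_eq_sum[of "Suc m" l] 0 by simp
    ultimately show ?case using 0 IH w by (auto simp: le_Suc_eq)
  qed
  then show "weight l = sum c {..<m}" "i \<ge> m \<Longrightarrow> l i = 0" "k \<le> m \<Longrightarrow> sum c {..<k} \<le> sum l {..<k}"
    by blast+
qed

text \<open>The only tableau whose content equals its shape has the entry \<open>i\<close>
  throughout row \<open>i\<close>. Truncation to \<open>m\<close> rows makes this inductive: a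
  surviving \<open>\<nu>\<close> has no row \<open>m\<close>, so it lies inside the shorter
  truncation and has the same weight.\<close>

lemma kostka_truncate:
  assumes "shape l"
  shows "kostka l m (\<lambda>i. if i < m then l i else 0) = 1"
proof (induction m)
  case (Suc m)
  define t where "t = (\<lambda>m i. if i < m then l i else 0)"
  have shape: "shape (t m)" for m
  proof -
    have "antimono (t m)"
      using shape_antimonoD[OF assms] by (auto simp: antimono_def t_def)
    moreover have "t m m = 0" by (simp add: t_def)
    ultimately show ?thesis unfolding shape_def by blast
  qed
  have w: "weight (t m) = sum l {..<m}" for m
    by (subst weight_eq_sum[of m]) (auto simp: t_def)
  have "t m \<in> hstrip (l m) (t (Suc m))"
    using shape_antimonoD[OF assms] by (auto simp: hstrip_def w strips_def) (auto simp: t_def)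
  moreover have "kostka l m \<nu> = 0" if \<nu>: "\<nu> \<in> hstrip (l m) (t (Suc m)) - {t m}" for \<nu>
  proof (rule ccontr)
    assume nz: "kostka l m \<nu> \<noteq> 0"
    have "\<nu> i \<le> t m i" for i
    proof (cases "i < m")
      case True
      then show ?thesis using \<nu> strips_le[of \<nu> "t (Suc m)" i] by (simp add: t_def hstrip_def)
    qed (use kostka_nonzeroD(3)[OF nz, of i] in simp)
    moreover have "weight \<nu> = weight (t m)"
      using kostka_nonzeroD(2)[OF nz] w by simp
    ultimately show False using weight_mono_eq(2)[OF shape] \<nu> by blast
  qed
  ultimately have "(\<Sum>\<nu>\<in>hstrip (l m) (t (Suc m)). kostka l m \<nu>) = kostka l m (t m)"
    by (subst sum.remove[of _ "t m"]) (auto simp: finite_hstrip shape)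
  then show ?case using Suc shape by (simp add: remove_strip_def t_def)
qed simp

lemma kostka_self:
  assumes "shape l" "\<And>i. i \<ge> m \<Longrightarrow> l i = 0"
  shows "kostka l m l = 1"
proof -
  have "(\<lambda>i. if i < m then l i else 0) = l" using assms(2) by auto
  with kostka_truncate[OF assms(1), of m] show ?thesis by simp
qed

section \<open>Adding a box: the Pieri rule for h_1\<close>

definition box_up :: "(nat \<Rightarrow> nat) \<Rightarrow> (nat \<Rightarrow> nat) set" where
  "box_up \<nu> = {l. shape l \<and> \<nu> \<in> hstrip 1 l}"

text \<open>The operator B. On shapes it is the transpose of \<open>remove_strip 1\<close>: the same
  relation between shapes, summed over the larger one.\<close>

definition sum_box_up :: "((nat \<Rightarrow> nat) \<Rightarrow> nat) \<Rightarrow> (nat \<Rightarrow> nat) \<Rightarrow> nat" where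
  "sum_box_up F \<nu> = (\<Sum>l\<in>box_up \<nu>. F l)"

lemma box_up_iff:
  assumes "shape \<nu>"
  shows "l \<in> box_up \<nu> \<longleftrightarrow> shape l \<and> (\<exists>i. l = \<nu>(i := Suc (\<nu> i)))"
proof
  assume "l \<in> box_up \<nu>"
  then have l: "shape l" "\<And>i. \<nu> i \<le> l i" "weight l = Suc (weight \<nu>)"
    by (auto simp: box_up_def hstrip_def strips_le)
  then show "shape l \<and> (\<exists>i. l = \<nu>(i := Suc (\<nu> i)))"
    using add_box_obtain[OF l(1) assms l(2,3)] by blast
next
  assume "shape l \<and> (\<exists>i. l = \<nu>(i := Suc (\<nu> i)))"
  then obtain i where l: "shape l" "l = \<nu>(i := Suc (\<nu> i))" by blast
  have "\<nu> \<in> strips l"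
    unfolding strips_def
  proof (intro CollectI allI conjI)
    fix j
    show "\<nu> j \<le> l j" by (simp add: l)
    have "l (Suc j) \<le> l j" using shape_antimonoD[OF l(1)] by simp
    moreover have "\<nu> (Suc j) \<le> \<nu> j" using shape_antimonoD[OF assms] by simp
    ultimately show "l (Suc j) \<le> \<nu> j" by (auto simp: l split: if_splits)
  qed
  then show "l \<in> box_up \<nu>"
    using l weight_add_box[OF assms, of i] by (simp add: box_up_def hstrip_def)
qed

lemma finite_box_up: assumes "shape \<nu>" shows "finite (box_up \<nu>)"
proof -
  obtain N where N: "\<nu> N = 0" using assms by (auto simp: shape_def)
  have "box_up \<nu> \<subseteq> (\<lambda>i. \<nu>(i := Suc (\<nu> i))) ` {..N}"
  proof
    fix l assume "l \<in> box_up \<nu>"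
    then obtain i where l: "shape l" "l = \<nu>(i := Suc (\<nu> i))" using box_up_iff[OF assms] by blast
    have "i \<le> N"
    proof (rule ccontr)
      assume "\<not> i \<le> N"
      then show False using shape_antimonoD[OF l(1), of N i] N by (simp add: l)
    qed
    with l show "l \<in> (\<lambda>i. \<nu>(i := Suc (\<nu> i))) ` {..N}" by blast
  qed
  then show ?thesis by (rule finite_subset) simp
qed

text \<open>This is the matrix entry at \<open>(l, \<nu>)\<close> of the commutation relation
  between B and U_a. Under the weight condition the last term says that \<open>l / \<nu>\<close> is
  a strip of size a - 1; written without subtraction, it also covers \<open>a = 0\<close>, where it
  vanishes.\<close>

lemma card_box_strip_commute:
  assumes "shape l" "shape \<nu>" "weight \<nu> + a = Suc (weight l)"
  shows "card {\<mu> \<in> box_up l. \<nu> \<in> hstrip a \<mu>} =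
         card {\<rho> \<in> hstrip a l. \<nu> \<in> box_up \<rho>} + of_bool (\<nu> \<in> strips l)"
proof -
  \<comment> \<open>Both families of intermediate shapes are indexed by the row in which the box is
    added to \<open>l\<close> or removed from \<open>\<nu>\<close>. In \<open>C\<close> the
    condition \<open>\<nu> i > 0\<close> guards the truncated subtraction.\<close>
  define A where "A = {i. \<nu> \<in> strips (l(i := Suc (l i)))}"
  define C where "C = {i. \<nu> i > 0 \<and> \<nu>(i := \<nu> i - 1) \<in> strips l}"
  have dec\<nu>: "\<nu> (Suc i) \<le> \<nu> i" and decl: "l (Suc i) \<le> l i" for i
    using assms shape_antimonoD by auto
  have "{\<mu> \<in> box_up l. \<nu> \<in> hstrip a \<mu>} = (\<lambda>i. l(i := Suc (l i))) ` A"
    using assms strips_shape[of \<nu>] weight_add_box[OF assms(1)]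
    by (auto simp: box_up_iff A_def hstrip_def image_iff)
  moreover have "inj_on (\<lambda>i. l(i := Suc (l i))) A"
    by (rule inj_onI) (metis fun_upd_same fun_upd_other n_not_Suc_n)
  ultimately have cardA: "card {\<mu> \<in> box_up l. \<nu> \<in> hstrip a \<mu>} = card A"
    by (simp add: card_image)
  have "{\<rho> \<in> hstrip a l. \<nu> \<in> box_up \<rho>} = (\<lambda>i. \<nu>(i := \<nu> i - 1)) ` C"
  proof (intro equalityI subsetI)
    fix \<rho> assume \<rho>: "\<rho> \<in> {\<rho> \<in> hstrip a l. \<nu> \<in> box_up \<rho>}"
    then have "shape \<rho>" using assms strips_shape by (auto simp: hstrip_def)
    with \<rho> obtain i where "\<nu> = \<rho>(i := Suc (\<rho> i))" using box_up_iff by blast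
    then have "\<rho> = \<nu>(i := \<nu> i - 1)" "\<nu> i > 0" by auto
    with \<rho> show "\<rho> \<in> (\<lambda>i. \<nu>(i := \<nu> i - 1)) ` C"
      by (auto simp: C_def hstrip_def)
  next
    fix \<rho> assume "\<rho> \<in> (\<lambda>i. \<nu>(i := \<nu> i - 1)) ` C"
    then obtain i where i: "\<nu> i > 0" "\<rho> = \<nu>(i := \<nu> i - 1)" "\<rho> \<in> strips l"
      by (auto simp: C_def)
    then have "\<nu> = \<rho>(i := Suc (\<rho> i))" by auto
    moreover have "shape \<rho>" using i assms strips_shape by blast
    ultimately show "\<rho> \<in> {\<rho> \<in> hstrip a l. \<nu> \<in> box_up \<rho>}"
      using assms(2,3) i(3) weight_add_box[of \<rho> i] box_up_iff[of \<rho> \<nu>] by (auto simp: hstrip_def)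
  qed
  moreover have "inj_on (\<lambda>i. \<nu>(i := \<nu> i - 1)) C"
  proof (rule inj_onI)
    fix i j assume "i \<in> C" "j \<in> C" and eq: "\<nu>(i := \<nu> i - 1) = \<nu>(j := \<nu> j - 1)"
    then have "\<nu> i > 0" by (simp add: C_def)
    with fun_cong[OF eq, of i] show "i = j" by (auto split: if_splits)
  qed
  ultimately have cardC: "card {\<rho> \<in> hstrip a l. \<nu> \<in> box_up \<rho>} = card C"
    by (simp add: card_image)
  have finC: "finite C"
  proof -
    obtain N where N: "\<And>i. i \<ge> N \<Longrightarrow> \<nu> i = 0" using assms(2) shape_eventually_0 by blast
    have "C \<subseteq> {..<N}"
    proof
      fix i assume "i \<in> C"
      with N[of i] show "i \<in> {..<N}" by (cases "N \<le> i") (auto simp: C_def)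
    qed
    then show ?thesis by (rule finite_subset) simp
  qed
  \<comment> \<open>If \<open>\<nu>\<close> interlaces with \<open>l\<close>, a box can be added to row \<open>i + 1\<close> of \<open>l\<close> iff one can
    be removed from row \<open>i\<close> of \<open>\<nu>\<close>, and row \<open>0\<close> of \<open>l\<close> is always free. Otherwise both
    sides count the only row \<open>i\<close> with \<open>\<nu> i = l i + 1\<close>, if any.\<close>
  show ?thesis
  proof (cases "\<nu> \<in> strips l")
    case True
    note le = strips_le[OF True] and ge = strips_ge[OF True]
    have "i \<in> C \<longleftrightarrow> l (Suc i) < \<nu> i" for i
      using le ge by (auto simp: C_def strips_def) (metis Suc_pred less_Suc_eq_le less_imp_le_nat diff_le_self order_trans)+
    moreover have "i \<in> A \<longleftrightarrow> i = 0 \<or> l i < \<nu> (i - 1)" for i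
      using le ge by (cases i) (auto simp: A_def strips_def le_SucI Suc_le_eq)
    ultimately have "A = insert 0 (Suc ` C)"
      by (auto simp: image_iff) (metis Suc_pred diff_Suc_1 gr0I)+
    then have "card A = Suc (card C)" using finC by (simp add: card_image)
    with True cardA cardC show ?thesis by simp
  next
    case False
    have "i \<in> A \<longleftrightarrow> i \<in> C" for i
    proof
      assume i: "i \<in> A"
      have le: "\<nu> j \<le> l j" if "j \<noteq> i" for j using i that by (auto simp: A_def strips_def split: if_splits)
      have ge: "l (Suc j) \<le> \<nu> j" for j
        using i by (force simp: A_def strips_def split: if_splits)
      have "\<nu> i \<le> Suc (l i)" using i by (auto simp: A_def strips_def split: if_splits)
      moreover have "\<not> \<nu> i \<le> l i"
      proof
        assume "\<nu> i \<le> l i"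
        then have "\<nu> j \<le> l j" for j using le by (cases "j = i") auto
        with ge False show False by (simp add: strips_def)
      qed
      ultimately have "\<nu> i = Suc (l i)" by simp
      with le ge decl show "i \<in> C" by (auto simp: C_def strips_def)
    next
      assume i: "i \<in> C"
      then have pos: "\<nu> i > 0" by (simp add: C_def)
      have le: "\<nu> j \<le> l j" if "j \<noteq> i" for j using i that by (auto simp: C_def strips_def split: if_splits)
      have ge: "l (Suc j) \<le> \<nu> j" for j
        using i by (force simp: C_def strips_def split: if_splits)
      have "\<nu> i \<le> Suc (l i)" using i pos by (auto simp: C_def strips_def split: if_splits)
      moreover have "\<not> \<nu> i \<le> l i"
      proof
        assume "\<nu> i \<le> l i"
        then have "\<nu> j \<le> l j" for j using le by (cases "j = i") auto
        with ge False show False by (simp add: strips_def)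
      qed
      ultimately have eq: "\<nu> i = Suc (l i)" by simp
      have "Suc (l i) \<le> \<nu> j" if "i = Suc j" for j using dec\<nu>[of j] eq that by simp
      with le ge eq show "i \<in> A" by (auto simp: A_def strips_def)
    qed
    then have "A = C" by blast
    with False cardA cardC show ?thesis by simp
  qed
qed

lemma sum_sum_eq_sum_card:
  fixes F :: "'b \<Rightarrow> nat"
  assumes "finite X" "finite W" "\<And>x. x \<in> X \<Longrightarrow> H x \<subseteq> W"
  shows "(\<Sum>x\<in>X. \<Sum>y\<in>H x. F y) = (\<Sum>y\<in>W. F y * card {x \<in> X. y \<in> H x})"
proof -
  have "(\<Sum>x\<in>X. \<Sum>y\<in>H x. F y) = (\<Sum>x\<in>X. \<Sum>y | y \<in> W \<and> y \<in> H x. F y)"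
    using assms(3) by (intro sum.cong) auto
  also have "\<dots> = (\<Sum>y\<in>W. \<Sum>x | x \<in> X \<and> y \<in> H x. F y)"
    by (rule sum.swap_restrict) fact+
  finally show ?thesis by (simp add: mult.commute)
qed

lemma sum_box_up_remove_strip:
  assumes l: "shape l"
  shows "sum_box_up (remove_strip a F) l =
    remove_strip a (sum_box_up F) l + (if a > 0 then remove_strip (a - 1) F l else 0)"
proof -
  \<comment> \<open>\<open>T\<close> indexes the sum for U_(a-1) and is empty for
    \<open>a = 0\<close>. \<open>W\<close> is one finite range for all three sums, so that they can
    be compared term by term in \<open>\<nu>\<close>.\<close>
  define T where "T = {\<nu> \<in> strips l. Suc (weight l) = weight \<nu> + a}"
  define W where "W = (\<Union>\<mu>\<in>box_up l. hstrip a \<mu>) \<union> (\<Union>\<rho>\<in>hstrip a l. box_up \<rho>) \<union> T"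
  have shape_hstrip: "shape \<nu>" if "\<nu> \<in> hstrip b \<mu>" "shape \<mu>" for \<nu> \<mu> b
    using that strips_shape by (auto simp: hstrip_def)
  have shape_up: "shape \<mu>" if "\<mu> \<in> box_up \<nu>" for \<mu> \<nu> using that by (simp add: box_up_def)
  have "finite T" unfolding T_def using finite_strips[OF l] by simp
  then have finW: "finite W" unfolding W_def
    using finite_box_up finite_hstrip l shape_hstrip shape_up by blast
  have W: "shape \<nu> \<and> weight \<nu> + a = Suc (weight l)" if "\<nu> \<in> W" for \<nu>
    using that l strips_shape by (auto simp: W_def T_def box_up_def hstrip_def)
  have T: "sum F T = (\<Sum>\<nu>\<in>W. F \<nu> * of_bool (\<nu> \<in> strips l))"
  proof (rule sum.mono_neutral_cong_left)
    show "T \<subseteq> W" by (simp add: W_def)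
    show "\<forall>\<nu>\<in>W - T. F \<nu> * of_bool (\<nu> \<in> strips l) = 0" using W by (fastforce simp: T_def)
  qed (use finW in \<open>auto simp: T_def\<close>)
  have "sum_box_up (remove_strip a F) l = (\<Sum>\<mu>\<in>box_up l. \<Sum>\<nu>\<in>hstrip a \<mu>. F \<nu>)"
    unfolding sum_box_up_def remove_strip_def using shape_up by (intro sum.cong) auto
  also have "\<dots> = (\<Sum>\<nu>\<in>W. F \<nu> * card {\<mu> \<in> box_up l. \<nu> \<in> hstrip a \<mu>})"
    using finite_box_up[OF l] finW by (rule sum_sum_eq_sum_card) (auto simp: W_def)
  also have "\<dots> = (\<Sum>\<nu>\<in>W. F \<nu> * card {\<rho> \<in> hstrip a l. \<nu> \<in> box_up \<rho>} + F \<nu> * of_bool (\<nu> \<in> strips l))"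
    using card_box_strip_commute[OF l] W by (intro sum.cong) (auto simp: algebra_simps)
  also have "\<dots> = (\<Sum>\<rho>\<in>hstrip a l. \<Sum>\<nu>\<in>box_up \<rho>. F \<nu>) + sum F T"
    unfolding T sum.distrib
    by (subst sum_sum_eq_sum_card[OF finite_hstrip[OF l] finW]) (auto simp: W_def)
  also have "(\<Sum>\<rho>\<in>hstrip a l. \<Sum>\<nu>\<in>box_up \<rho>. F \<nu>) = remove_strip a (sum_box_up F) l"
    using l by (simp add: remove_strip_def sum_box_up_def)
  also have "sum F T = (if a > 0 then remove_strip (a - 1) F l else 0)"
  proof (cases "a > 0")
    case True
    then have "T = hstrip (a - 1) l" by (auto simp: T_def hstrip_def)
    with True l show ?thesis by (simp add: remove_strip_def)
  next
    case False
    have "T = {}"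
    proof (rule ccontr)
      assume "T \<noteq> {}"
      then obtain \<nu> where "\<nu> \<in> strips l" "Suc (weight l) = weight \<nu>" using False by (auto simp: T_def)
      with weight_mono_eq(1)[OF l, of \<nu>] strips_le show False by force
    qed
    with False show ?thesis by simp
  qed
  finally show ?thesis .
qed

lemma remove_strip_cong:
  "(\<And>\<nu>. shape \<nu> \<Longrightarrow> F \<nu> = G \<nu>) \<Longrightarrow> remove_strip a F = remove_strip a G"
  using strips_shape by (auto simp: remove_strip_def hstrip_def fun_eq_iff intro!: sum.cong)

text \<open>B is moved through the product of the operators U. Passing the factor of a letter
  \<open>i\<close> with \<open>c i > 0\<close> leaves one extra term, in which that multiplicity is
  lowered by one; at the end B meets the indicator of the empty shape and gives 0, since adding a
  box never yields the empty shape.\<close>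

lemma kostka_Pieri:
  assumes "shape l"
  shows "sum_box_up (kostka c m) l = (\<Sum>i | i < m \<and> c i > 0. kostka (c(i := c i - 1)) m l)"
  using assms
proof (induction m arbitrary: l)
  case 0
  have "(\<lambda>_. 0) \<notin> box_up l" using box_up_iff[OF 0] by (auto simp: fun_eq_iff)
  then show ?case by (auto simp: sum_box_up_def intro!: sum.neutral)
next
  case (Suc m)
  let ?I = "{i. i < m \<and> c i > 0}"
  have "sum_box_up (kostka c (Suc m)) l =
      remove_strip (c m) (sum_box_up (kostka c m)) l +
      (if c m > 0 then remove_strip (c m - 1) (kostka c m) l else 0)"
    using sum_box_up_remove_strip[OF Suc.prems] by simp
  also have "remove_strip (c m) (sum_box_up (kostka c m)) =
      remove_strip (c m) (\<lambda>l. \<Sum>i\<in>?I. kostka (c(i := c i - 1)) m l)"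
    by (rule remove_strip_cong) (rule Suc.IH)
  also have "\<dots> l = (\<Sum>i\<in>?I. remove_strip (c m) (kostka (c(i := c i - 1)) m) l)"
    by (simp add: remove_strip_def sum.swap[of _ ?I])
  also have "\<dots> = (\<Sum>i\<in>?I. kostka (c(i := c i - 1)) (Suc m) l)"
    by (intro sum.cong) auto
  also have "kostka c m = kostka (c(m := c m - 1)) m"
    by (rule kostka_cong) auto
  finally have *: "sum_box_up (kostka c (Suc m)) l = (\<Sum>i\<in>?I. kostka (c(i := c i - 1)) (Suc m) l) +
      (if c m > 0 then kostka (c(m := c m - 1)) (Suc m) l else 0)"
    by (simp only: kostka.simps fun_upd_same)
  have "{i. i < Suc m \<and> c i > 0} = (if c m > 0 then insert m ?I else ?I)"
    by (auto simp: less_Suc_eq)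
  then show ?case unfolding * by (cases "c m > 0") (simp_all add: add.commute del: kostka.simps fun_upd_apply)
qed

definition shapes :: "nat \<Rightarrow> (nat \<Rightarrow> nat) set" where
  "shapes n = {l. shape l \<and> weight l = n}"

lemma shapes_bounds:
  assumes "l \<in> shapes n"
  shows "l i \<le> n" "i \<ge> n \<Longrightarrow> l i = 0"
proof -
  have l: "shape l" "weight l = n" using assms by (auto simp: shapes_def)
  obtain N where N: "\<And>i. i \<ge> N \<Longrightarrow> l i = 0" using l(1) shape_eventually_0 by blast
  have le: "sum l {..i} \<le> n"
  proof -
    have "n = sum l {..<max N (Suc i)}" unfolding l(2)[symmetric] by (rule weight_eq_sum) (simp add: N)
    moreover have "sum l {..i} \<le> sum l {..<max N (Suc i)}" by (rule sum_mono2) auto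
    ultimately show ?thesis by simp
  qed
  have "l i \<le> sum l {..i}" by (rule member_le_sum) auto
  with le show "l i \<le> n" by simp
  show "l i = 0" if "i \<ge> n"
  proof (rule ccontr)
    assume "l i \<noteq> 0"
    then have "1 \<le> l j" if "j \<le> i" for j using shape_antimonoD[OF l(1) that] by simp
    then have "(\<Sum>j\<le>i. 1) \<le> sum l {..i}" by (intro sum_mono) auto
    with le that show False by simp
  qed
qed

lemma finite_shapes: "finite (shapes n)"
proof -
  have "shapes n \<subseteq> {f. \<forall>x. (x \<in> {..<n} \<longrightarrow> f x \<in> {..n}) \<and> (x \<notin> {..<n} \<longrightarrow> f x = 0)}"
    using shapes_bounds by auto
  moreover have "finite \<dots>" by (rule finite_set_of_finite_funs) auto
  ultimately show ?thesis by (rule finite_subset)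
qed

text \<open>One step of the recursion for standard content is \<open>remove_strip 1\<close>;
  exchanging the two sums moves it to \<open>G\<close> as its transpose.\<close>

lemma sum_kostka_box_up:
  "(\<Sum>l\<in>shapes (Suc n). kostka (\<lambda>_. 1) (Suc n) l * G l) =
   (\<Sum>l\<in>shapes n. kostka (\<lambda>_. 1) n l * sum_box_up G l)"
proof -
  let ?k = "kostka (\<lambda>_. 1) n"
  have "(\<Sum>l\<in>shapes (Suc n). kostka (\<lambda>_. 1) (Suc n) l * G l) =
        (\<Sum>l\<in>shapes (Suc n). \<Sum>\<nu> | \<nu> \<in> shapes n \<and> \<nu> \<in> hstrip 1 l. ?k \<nu> * G l)"
  proof (rule sum.cong)
    fix l assume l: "l \<in> shapes (Suc n)"
    then have "{\<nu>. \<nu> \<in> shapes n \<and> \<nu> \<in> hstrip 1 l} = hstrip 1 l"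
      using strips_shape by (auto simp: shapes_def hstrip_def)
    with l show "kostka (\<lambda>_. 1) (Suc n) l * G l = (\<Sum>\<nu> | \<nu> \<in> shapes n \<and> \<nu> \<in> hstrip 1 l. ?k \<nu> * G l)"
      by (simp add: remove_strip_def shapes_def sum_distrib_right)
  qed simp
  also have "\<dots> = (\<Sum>\<nu>\<in>shapes n. \<Sum>l | l \<in> shapes (Suc n) \<and> \<nu> \<in> hstrip 1 l. ?k \<nu> * G l)"
    by (rule sum.swap_restrict) (rule finite_shapes)+
  also have "\<dots> = (\<Sum>\<nu>\<in>shapes n. ?k \<nu> * sum_box_up G \<nu>)"
  proof (rule sum.cong)
    fix \<nu> assume "\<nu> \<in> shapes n"
    then have "{l. l \<in> shapes (Suc n) \<and> \<nu> \<in> hstrip 1 l} = box_up \<nu>"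
      by (auto simp: shapes_def hstrip_def box_up_def)
    then show "(\<Sum>l | l \<in> shapes (Suc n) \<and> \<nu> \<in> hstrip 1 l. ?k \<nu> * G l) = ?k \<nu> * sum_box_up G \<nu>"
      by (simp add: sum_box_up_def sum_distrib_left)
  qed simp
  finally show ?thesis .
qed

section \<open>Semistandard tableaux\<close>

definition row :: "nat multiset \<Rightarrow> nat \<Rightarrow> nat" where
  "row \<mu> i = (if i < size \<mu> then parts \<mu> ! i else 0)"

definition partition_of_row :: "(nat \<Rightarrow> nat) \<Rightarrow> nat multiset" where
  "partition_of_row r = image_mset r (mset_set {i. r i \<noteq> 0})"

lemma mset_parts [simp]: "mset (parts \<mu>) = \<mu>"
  by (simp add: parts_def)

lemma length_parts [simp]: "length (parts \<mu>) = size \<mu>"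
  by (metis mset_parts size_mset)

lemma shape_row: "shape (row \<mu>)"
proof -
  have "sorted (rev (parts \<mu>))" by (simp add: parts_def)
  then have "antimono (row \<mu>)"
    by (auto simp: antimono_def row_def sorted_rev_iff_nth_mono)
  moreover have "row \<mu> (size \<mu>) = 0" by (simp add: row_def)
  ultimately show ?thesis unfolding shape_def by blast
qed

lemma weight_row: "weight (row \<mu>) = \<Sum>\<^sub># \<mu>"
proof -
  have "weight (row \<mu>) = (\<Sum>i<size \<mu>. row \<mu> i)"
    by (rule weight_eq_sum) (simp add: row_def)
  also have "\<dots> = sum_list (parts \<mu>)"
    by (simp add: sum_list_sum_nth row_def lessThan_atLeast0)
  also have "\<dots> = \<Sum>\<^sub># \<mu>" by (metis mset_parts sum_mset_sum_list)
  finally show ?thesis .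
qed

lemma row_eq_0_iff: "partition \<mu> \<Longrightarrow> row \<mu> i = 0 \<longleftrightarrow> i \<ge> size \<mu>"
proof -
  assume "partition \<mu>"
  then have "0 \<notin> set (parts \<mu>)" unfolding partition_def by (metis mset_parts set_mset_mset)
  moreover have "parts \<mu> ! i \<in> set (parts \<mu>)" if "i < size \<mu>" using that by simp
  ultimately have "row \<mu> i \<noteq> 0" if "i < size \<mu>" using that by (metis row_def)
  then show ?thesis by (auto simp: row_def)
qed

lemma partition_of_row_row: assumes "partition \<mu>" shows "partition_of_row (row \<mu>) = \<mu>"
proof -
  have "{i. row \<mu> i \<noteq> 0} = {0..<size \<mu>}" using row_eq_0_iff[OF assms] by auto
  then have "partition_of_row (row \<mu>) = mset (map (row \<mu>) [0..<size \<mu>])"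
    by (simp add: partition_of_row_def)
  also have "map (row \<mu>) [0..<size \<mu>] = parts \<mu>"
    by (rule nth_equalityI) (auto simp: row_def)
  finally show ?thesis by simp
qed

lemma shape_nonzero:
  assumes "shape r" obtains k where "{i. r i \<noteq> 0} = {0..<k}"
proof -
  define k where "k = (LEAST k. r k = 0)"
  have "\<exists>k. r k = 0" using assms by (simp add: shape_def)
  then have k: "r k = 0" "\<And>i. r i = 0 \<Longrightarrow> k \<le> i"
    unfolding k_def by (auto intro: LeastI Least_le)
  have "r i = 0 \<longleftrightarrow> k \<le> i" for i using k shape_antimonoD[OF assms, of k i] by auto
  then have "{i. r i \<noteq> 0} = {0..<k}" by (auto simp: not_le)
  then show ?thesis by (rule that)
qed

lemma partition_partition_of_row: assumes "shape r" shows "partition (partition_of_row r)"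
proof -
  obtain k where "{i. r i \<noteq> 0} = {0..<k}" using shape_nonzero[OF assms] .
  then have "finite {i. r i \<noteq> 0}" by simp
  then show ?thesis by (auto simp: partition_def partition_of_row_def)
qed

lemma row_partition_of_row: assumes "shape r" shows "row (partition_of_row r) = r"
proof
  fix i
  obtain k where k: "{i. r i \<noteq> 0} = {0..<k}" using shape_nonzero[OF assms] .
  have eq: "partition_of_row r = mset (map r [0..<k])"
    unfolding partition_of_row_def k by simp
  have "sort (map r [0..<k]) = rev (map r [0..<k])"
    by (rule properties_for_sort)
      (auto simp: sorted_rev_iff_nth_mono intro: shape_antimonoD[OF assms])
  then have "parts (partition_of_row r) = map r [0..<k]"
    unfolding parts_def eq sorted_list_of_multiset_mset by (metis rev_rev_ident)
  moreover have "size (partition_of_row r) = k" by (simp add: eq)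
  moreover have "r i = 0" if "\<not> i < k" using k that by auto
  ultimately show "row (partition_of_row r) i = r i" by (simp add: row_def)
qed

lemma sum_partition_of_row: "shape r \<Longrightarrow> \<Sum>\<^sub># (partition_of_row r) = weight r"
  by (metis weight_row row_partition_of_row)

lemma bij_betw_row: "bij_betw row {\<mu>. partition_of n \<mu>} (shapes n)"
  by (rule bij_betwI[where g = partition_of_row])
    (auto simp: partition_of_def shapes_def shape_row weight_row partition_of_row_row
      partition_partition_of_row row_partition_of_row sum_partition_of_row)

section \<open>Tableaux and removal of the largest letter\<close>

definition diagram :: "(nat \<Rightarrow> nat) \<Rightarrow> (nat \<times> nat) set" where
  "diagram r = {(i, j). j < r i}"

text \<open>The tableaux of \<open>ssyt\<close> for a row-length function, so that the intermediate
  shapes of the recursion need not be turned back into multisets.\<close>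

definition tableaux :: "(nat \<Rightarrow> nat) \<Rightarrow> nat multiset \<Rightarrow> (nat \<times> nat \<Rightarrow> nat) set" where
  "tableaux r M = {T \<in> diagram r \<rightarrow>\<^sub>E UNIV.
     (\<forall>i j. Suc j < r i \<longrightarrow> T (i, j) \<le> T (i, Suc j)) \<and>
     (\<forall>i j. j < r (Suc i) \<longrightarrow> T (i, j) < T (Suc i, j)) \<and>
     image_mset T (mset_set (diagram r)) = M}"

lemma ssyt_conv_tableaux: "ssyt \<mu> M = tableaux (row \<mu>) M"
proof -
  have "cells \<mu> = diagram (row \<mu>)" by (auto simp: cells_def diagram_def row_def split: if_splits)
  then show ?thesis by (simp add: ssyt_def tableaux_def diagram_def)
qed

lemma diagram_Sigma: "diagram r = Sigma {i. r i \<noteq> 0} (\<lambda>i. {..<r i})"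
  by (auto simp: diagram_def)

lemma finite_shape_nonzero: "shape r \<Longrightarrow> finite {i. r i \<noteq> 0}"
  by (erule shape_nonzero) (simp only: finite_atLeastLessThan)

lemma finite_diagram: "shape r \<Longrightarrow> finite (diagram r)"
  unfolding diagram_Sigma using finite_shape_nonzero[of r] by (intro finite_SigmaI) auto

lemma card_diagram: "shape r \<Longrightarrow> card (diagram r) = weight r"
  unfolding diagram_Sigma weight_def using finite_shape_nonzero[of r] by (subst card_SigmaI) auto

text \<open>Applied to the cells of a row with entries below \<open>m\<close>: they form an initial
  segment, so their number is the length of the row that remains.\<close>

lemma downset_eq_lessThan_card:
  fixes S :: "nat set"
  assumes "finite S" "\<And>i j. j \<in> S \<Longrightarrow> i \<le> j \<Longrightarrow> i \<in> S"
  shows "S = {..<card S}"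
proof (cases "S = {}")
  case False
  have "S = {..Max S}"
  proof (intro equalityI subsetI)
    show "i \<in> {..Max S}" if "i \<in> S" for i using Max_ge[OF assms(1) that] by simp
    show "i \<in> S" if "i \<in> {..Max S}" for i using assms(2)[OF Max_in[OF assms(1) False]] that by simp
  qed
  moreover from this have "card S = Suc (Max S)" by (metis card_atMost)
  ultimately show ?thesis by (simp only: lessThan_Suc_atMost)
qed simp

lemma tableaux_row_mono:
  assumes "T \<in> tableaux r M" "j \<le> k" "k < r i"
  shows "T (i, j) \<le> T (i, k)"
  using assms(2,3)
proof (induction k rule: dec_induct)
  case (step k)
  then have "T (i, k) \<le> T (i, Suc k)" using assms(1) by (simp add: tableaux_def)
  with step show ?case by simp
qed simp

lemma tableaux_entry:
  assumes "T \<in> tableaux r M" "shape r" "p \<in> diagram r"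
  shows "T p \<in># M"
proof -
  have "M = image_mset T (mset_set (diagram r))" using assms(1) by (simp add: tableaux_def)
  then show ?thesis using assms finite_diagram by simp
qed

text \<open>Since rows increase weakly, the entries \<open>m\<close> occupy the ends of rows, and
  the remaining cells form a diagram. Since columns increase strictly, no two entries
  \<open>m\<close> share a column, which is the interlacing condition. The inverse fills the cells
  outside \<open>\<nu>\<close> with \<open>m\<close>.\<close>

lemma bij_betw_peel_largest:
  assumes r: "shape r" and M: "set_mset M \<subseteq> {..<Suc m}"
  shows "bij_betw
    (\<lambda>T. let \<nu> = (\<lambda>i. card {j. j < r i \<and> T (i, j) < m}) in (\<nu>, restrict T (diagram \<nu>)))
    (tableaux r M)
    (Sigma (hstrip (count M m) r) (\<lambda>\<nu>. tableaux \<nu> (filter_mset (\<lambda>x. x \<noteq> m) M)))"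
    (is "bij_betw ?f ?A ?B")
proof (rule bij_betwI)
  let ?\<nu> = "\<lambda>T i. card {j. j < r i \<and> T (i, j) < m}"
  let ?M' = "filter_mset (\<lambda>x. x \<noteq> m) M"
  let ?g = "\<lambda>(\<nu>, T'). restrict (\<lambda>p. if p \<in> diagram \<nu> then T' p else m) (diagram r)"
  have size_M: "size M = size ?M' + count M m"
    using arg_cong[OF multiset_partition[of M "\<lambda>x. x \<noteq> m"], of size] by (simp add: filter_eq_replicate_mset)
  have le_m: "T p \<le> m" if "T \<in> ?A" "p \<in> diagram r" for T p
    using tableaux_entry[OF that(1) r that(2)] M by auto
  have \<nu>: "j < ?\<nu> T i \<longleftrightarrow> j < r i \<and> T (i, j) < m" if T: "T \<in> ?A" for T i j
  proof -
    have "{j. j < r i \<and> T (i, j) < m} = {..<?\<nu> T i}"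
    proof (rule downset_eq_lessThan_card)
      fix j k assume "k \<in> {j. j < r i \<and> T (i, j) < m}" "j \<le> k"
      then show "j \<in> {j. j < r i \<and> T (i, j) < m}"
        using tableaux_row_mono[OF T, of j k i] by simp
    qed simp
    then show ?thesis by blast
  qed
  have diagram_\<nu>: "diagram (?\<nu> T) = {p \<in> diagram r. T p \<noteq> m}" if T: "T \<in> ?A" for T
    using \<nu>[OF T] le_m[OF T] by (auto simp: diagram_def) (metis le_neq_implies_less)
  show "?f \<in> ?A \<rightarrow> ?B"
  proof
    fix T assume T: "T \<in> ?A"
    have strips: "?\<nu> T \<in> strips r"
      unfolding strips_def
    proof (intro CollectI allI conjI)
      fix i
      show "?\<nu> T i \<le> r i" using \<nu>[OF T, of "r i" i] by simp
      show "r (Suc i) \<le> ?\<nu> T i"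
      proof (rule ccontr)
        \<comment> \<open>Column \<open>?\<nu> T i\<close> is the leftmost one in which row
          \<open>i\<close> has no entry below \<open>m\<close>, but strict increase down that column
          would put one there.\<close>
        assume *: "\<not> r (Suc i) \<le> ?\<nu> T i"
        then have "T (i, ?\<nu> T i) < T (Suc i, ?\<nu> T i)" "T (Suc i, ?\<nu> T i) \<le> m"
          using T le_m[OF T, of "(Suc i, ?\<nu> T i)"] by (simp_all add: tableaux_def diagram_def)
        moreover have "?\<nu> T i < r i" using * shape_antimonoD[OF r, of i "Suc i"] by simp
        ultimately show False using \<nu>[OF T, of "?\<nu> T i" i] by simp
      qed
    qed
    have shape: "shape (?\<nu> T)" using strips_shape[OF strips] r by simp
    have content: "image_mset T (mset_set (diagram (?\<nu> T))) = ?M'"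
    proof -
      have "?M' = filter_mset (\<lambda>x. x \<noteq> m) (image_mset T (mset_set (diagram r)))"
        using T by (simp add: tableaux_def)
      also have "\<dots> = image_mset T (filter_mset (\<lambda>p. T p \<noteq> m) (mset_set (diagram r)))"
        by (simp add: filter_mset_image_mset)
      also have "\<dots> = image_mset T (mset_set (diagram (?\<nu> T)))"
        using finite_diagram[OF r] by (simp add: diagram_\<nu>[OF T])
      finally show ?thesis ..
    qed
    have content': "image_mset (restrict T (diagram (?\<nu> T))) (mset_set (diagram (?\<nu> T))) = ?M'"
      unfolding content[symmetric] using finite_diagram[OF shape] by (intro image_mset_cong) simp
    have "weight r = size M"
      using T card_diagram[OF r] by (auto simp: tableaux_def)
    moreover have "weight (?\<nu> T) = size ?M'"
      using arg_cong[OF content, of size] card_diagram[OF shape] by simp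
    ultimately have "?\<nu> T \<in> hstrip (count M m) r" using strips size_M by (simp add: hstrip_def)
    moreover have "restrict T (diagram (?\<nu> T)) \<in> tableaux (?\<nu> T) ?M'"
    proof -
      have "restrict T (diagram (?\<nu> T)) (i, j) \<le> restrict T (diagram (?\<nu> T)) (i, Suc j)"
        if "Suc j < ?\<nu> T i" for i j
        using that \<nu>[OF T, of "Suc j" i] T by (simp add: diagram_def tableaux_def)
      moreover have "restrict T (diagram (?\<nu> T)) (i, j) < restrict T (diagram (?\<nu> T)) (Suc i, j)"
        if "j < ?\<nu> T (Suc i)" for i j
        using that \<nu>[OF T, of j "Suc i"] T shape_antimonoD[OF shape, of i "Suc i"]
        by (simp add: diagram_def tableaux_def)
      ultimately show ?thesis
        using content' by (simp add: tableaux_def)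
    qed
    ultimately show "?f T \<in> ?B" by (simp add: Let_def)
  qed
  have B: "\<nu> \<in> strips r" "shape \<nu>" "weight r = weight \<nu> + count M m" "T' \<in> tableaux \<nu> ?M'" "diagram \<nu> \<subseteq> diagram r"
    "\<And>p. p \<in> diagram \<nu> \<Longrightarrow> T' p < m"
    if "(\<nu>, T') \<in> ?B" for \<nu> T'
  proof -
    show *: "\<nu> \<in> strips r" "T' \<in> tableaux \<nu> ?M'" "weight r = weight \<nu> + count M m"
      using that by (auto simp: hstrip_def)
    then show "shape \<nu>" using strips_shape r by blast
    then show "T' p < m" if "p \<in> diagram \<nu>" for p
      using tableaux_entry[OF *(2) _ that] M by force
    show "diagram \<nu> \<subseteq> diagram r" using strips_le[OF *(1)] by (auto simp: diagram_def intro: less_le_trans)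
  qed
  show "?g \<in> ?B \<rightarrow> ?A"
  proof
    fix z assume z: "z \<in> ?B"
    obtain \<nu> T' where z_eq: "z = (\<nu>, T')" by (cases z)
    note B = B[OF z[unfolded z_eq]]
    define T where "T = ?g z"
    have T: "T (i, j) = (if j < \<nu> i then T' (i, j) else m)" if "j < r i" for i j
      using that by (simp add: T_def z_eq diagram_def)
    have "T (i, j) \<le> T (i, Suc j)" if "Suc j < r i" for i j
      using that B(4) B(6)[of "(i, j)"] by (auto simp: T tableaux_def diagram_def)
    moreover have "T (i, j) < T (Suc i, j)" if "j < r (Suc i)" for i j
    proof -
      \<comment> \<open>Interlacing puts the upper cell in the old diagram, where entries are below
        \<open>m\<close>; the lower cell may be old or filled with \<open>m\<close>.\<close>
      have "j < \<nu> i" "j < r i"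
        using that strips_ge[OF B(1), of i] shape_antimonoD[OF r, of i "Suc i"] by simp_all
      then show ?thesis using that B(4) B(6)[of "(i, j)"] by (auto simp: T tableaux_def diagram_def)
    qed
    moreover have "image_mset T (mset_set (diagram r)) = M"
    proof -
      have fin: "finite (diagram \<nu>)" "finite (diagram r - diagram \<nu>)"
        using finite_diagram r B(2) by auto
      have "mset_set (diagram r) = mset_set (diagram \<nu>) + mset_set (diagram r - diagram \<nu>)"
        using mset_set_Union[OF fin] B(5) by (simp add: Un_absorb1)
      then have "image_mset T (mset_set (diagram r)) =
          image_mset T (mset_set (diagram \<nu>)) + image_mset T (mset_set (diagram r - diagram \<nu>))"
        by simp
      also have "image_mset T (mset_set (diagram \<nu>)) = image_mset T' (mset_set (diagram \<nu>))"
        using fin B(5) by (intro image_mset_cong) (auto simp: T_def z_eq)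
      also have "\<dots> = ?M'" using B(4) by (simp add: tableaux_def)
      also have "image_mset T (mset_set (diagram r - diagram \<nu>)) =
          image_mset (\<lambda>_. m) (mset_set (diagram r - diagram \<nu>))"
        using fin by (intro image_mset_cong) (auto simp: T_def z_eq)
      also have "\<dots> = replicate_mset (count M m) m"
        using card_Diff_subset[OF fin(1) B(5)] card_diagram r B(2,3) by (simp add: image_mset_const_eq)
      also have "?M' + \<dots> = M" by (rule multiset_eqI) simp
      finally show ?thesis .
    qed
    moreover have "T \<in> diagram r \<rightarrow>\<^sub>E UNIV" by (auto simp: T_def z_eq)
    ultimately show "?g z \<in> ?A" unfolding T_def[symmetric] by (simp add: tableaux_def)
  qed
  show "?g (?f T) = T" if T: "T \<in> ?A" for T
  proof
    fix p
    have "T \<in> diagram r \<rightarrow>\<^sub>E UNIV" using T by (simp add: tableaux_def)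
    then have "T p = undefined" if "p \<notin> diagram r" using that by (rule PiE_arb)
    then show "?g (?f T) p = T p"
      unfolding Let_def prod.case diagram_\<nu>[OF T] by auto
  qed
  show "?f (?g z) = z" if z: "z \<in> ?B" for z
  proof -
    obtain \<nu> T' where z_eq: "z = (\<nu>, T')" by (cases z)
    note B = B[OF z[unfolded z_eq]]
    have "{j. j < r i \<and> ?g z (i, j) < m} = {..<\<nu> i}" for i
      using B(6)[of "(i, _)"] strips_le[OF B(1), of i] by (auto simp: z_eq diagram_def)
    then have 1: "?\<nu> (?g z) = \<nu>" by (simp add: fun_eq_iff)
    have "T' \<in> diagram \<nu> \<rightarrow>\<^sub>E UNIV" using B(4) by (simp add: tableaux_def)
    then have "T' p = undefined" if "p \<notin> diagram \<nu>" for p using that by (rule PiE_arb)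
    moreover have "?g z p = T' p" if "p \<in> diagram \<nu>" for p
      using that subsetD[OF B(5) that] by (simp add: z_eq)
    ultimately have "restrict (?g z) (diagram \<nu>) p = T' p" for p
      by (cases "p \<in> diagram \<nu>") simp_all
    then have "restrict (?g z) (diagram \<nu>) = T'" by blast
    with 1 show ?thesis by (simp add: Let_def z_eq)
  qed
qed

text \<open>Finiteness is carried through the induction because the cardinality of the dependent sum
  is the sum of the cardinalities only for finite fibres.\<close>

lemma card_tableaux:
  assumes "shape r" "set_mset M \<subseteq> {..<m}"
  shows "finite (tableaux r M) \<and> card (tableaux r M) = kostka (count M) m r"
  using assms
proof (induction m arbitrary: r M)
  case 0
  then have M: "M = {#}" by simp
  show ?case
  proof (cases "r = (\<lambda>_. 0)")
    case True
    then have "tableaux r M = {\<lambda>_. undefined}" by (auto simp: tableaux_def diagram_def M)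
    with True show ?thesis by simp
  next
    case False
    then obtain i where "r i \<noteq> 0" by auto
    then have "(i, 0) \<in> diagram r" by (simp add: diagram_def)
    then have "diagram r \<noteq> {}" by blast
    then have "tableaux r M = {}"
      using finite_diagram[OF 0(1)] by (auto simp: tableaux_def M mset_set_empty_iff)
    with False show ?thesis by simp
  qed
next
  case (Suc m)
  let ?M' = "filter_mset (\<lambda>x. x \<noteq> m) M"
  have M': "set_mset ?M' \<subseteq> {..<m}" using Suc.prems(2) by auto
  have IH: "finite (tableaux \<nu> ?M')" "card (tableaux \<nu> ?M') = kostka (count M) m \<nu>"
    if "\<nu> \<in> hstrip (count M m) r" for \<nu>
  proof -
    have "shape \<nu>" using that Suc.prems(1) strips_shape by (auto simp: hstrip_def)
    moreover have "kostka (count ?M') m = kostka (count M) m" by (rule kostka_cong) simp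
    ultimately show "finite (tableaux \<nu> ?M')" "card (tableaux \<nu> ?M') = kostka (count M) m \<nu>"
      using Suc.IH[OF _ M', of \<nu>] by metis+
  qed
  note bij = bij_betw_peel_largest[OF Suc.prems]
  have "finite (Sigma (hstrip (count M m) r) (\<lambda>\<nu>. tableaux \<nu> ?M'))"
    using finite_hstrip[OF Suc.prems(1)] IH(1) by (rule finite_SigmaI)
  moreover have "card (Sigma (hstrip (count M m) r) (\<lambda>\<nu>. tableaux \<nu> ?M')) = kostka (count M) (Suc m) r"
    using finite_hstrip[OF Suc.prems(1)] IH Suc.prems(1) by (simp add: remove_strip_def)
  ultimately show ?case using bij_betw_finite[OF bij] bij_betw_same_card[OF bij] by simp
qed

section \<open>Coefficients of symmetric functions\<close>

lemmas mcoeff_simps [simp] =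
  zero_mseries.rep_eq plus_mseries.rep_eq scale.rep_eq map_mcoeff.rep_eq

lemma mcoeff_Mseries [simp]: "mcoeff (Mseries f) = f"
  by (rule Mseries_inverse) simp

lemma mcoeff_sum: "mcoeff (sum f A) M = (\<Sum>a\<in>A. mcoeff (f a) M)"
  by (induction A rule: infinite_finite_induct) simp_all

lemma subset_lessThan_Suc_Max: "finite A \<Longrightarrow> A \<subseteq> {..<Suc (Max (insert 0 A))}"
  by (auto simp: less_Suc_eq_le)

lemma card_ssyt: "set_mset M \<subseteq> {..<m} \<Longrightarrow> card (ssyt \<mu> M) = kostka (count M) m (row \<mu>)"
  using card_tableaux[OF shape_row] by (simp add: ssyt_conv_tableaux)

lemma mcoeff_schur: "mcoeff (schur \<mu>) M = of_nat (card (ssyt \<mu> M))"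
  by (simp add: schur_def)

lemma exponents_conv_filter:
  assumes "set_mset M \<subseteq> {..<m}"
  shows "exponents M = filter_mset (\<lambda>a. a \<noteq> 0) (image_mset (count M) (mset_set {..<m}))"
proof -
  have "{x \<in> {..<m}. count M x \<noteq> 0} = set_mset M" using assms by (auto simp: count_eq_zero_iff simp del: count_greater_zero_iff)
  then show ?thesis by (simp add: exponents_def filter_mset_image_mset)
qed

lemma sum_exponents: "\<Sum>\<^sub># (exponents M) = size M"
  by (simp add: exponents_def size_multiset_overloaded_eq sum_unfold_sum_mset)

lemma partition_exponents: "partition (exponents M)"
  by (auto simp: partition_def exponents_def not_in_iff[symmetric])

lemma card_ssyt_symmetric:
  assumes "exponents M = exponents M'"
  shows "card (ssyt \<mu> M) = card (ssyt \<mu> M')"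
proof -
  define m where "m = Suc (Max (insert 0 (set_mset M \<union> set_mset M')))"
  have m: "set_mset M \<subseteq> {..<m}" "set_mset M' \<subseteq> {..<m}"
    using subset_lessThan_Suc_Max[of "set_mset M \<union> set_mset M'"] by (simp_all add: m_def)
  have "kostka (count M) m = kostka (count M') m"
    by (rule kostka_symmetric)
      (simp only: assms exponents_conv_filter[OF m(1), symmetric] exponents_conv_filter[OF m(2), symmetric])
  then show ?thesis by (simp add: card_ssyt[OF m(1)] card_ssyt[OF m(2)])
qed

text \<open>Equal exponents, padded with zeros to \<open>m\<close> variables, are rearrangements of
  each other. The rearranging permutation of \<open>{..<m}\<close> fixes all other variables, so it
  is one of the bijections under which \<open>f\<close> is invariant.\<close>

lemma Sym_mcoeff_eq:
  assumes f: "f \<in> Sym" and eq: "exponents M = exponents M'"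
  shows "mcoeff f M = mcoeff f M'"
proof -
  define m where "m = Suc (Max (insert 0 (set_mset M \<union> set_mset M')))"
  have m: "set_mset M \<subseteq> {..<m}" "set_mset M' \<subseteq> {..<m}"
    using subset_lessThan_Suc_Max[of "set_mset M \<union> set_mset M'"] by (simp_all add: m_def)
  let ?A = "\<lambda>M. image_mset (count M) (mset_set {..<m})"
  have A: "?A N = exponents N + replicate_mset (m - size (exponents N)) 0"
    if "set_mset N \<subseteq> {..<m}" for N
  proof -
    have *: "?A N = exponents N + replicate_mset (count (?A N) 0) 0"
      using multiset_partition[of "?A N" "\<lambda>a. a \<noteq> 0"]
      by (simp add: exponents_conv_filter[OF that] filter_eq_replicate_mset)
    from arg_cong[OF this, of size] have "count (?A N) 0 = m - size (exponents N)"
      by simp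
    with * show ?thesis by simp
  qed
  have "?A M = ?A M'" using A[OF m(1)] A[OF m(2)] eq by simp
  then obtain p where p: "p permutes {..<m}" "\<forall>x\<in>{..<m}. count M x = count M' (p x)"
    using image_mset_eq_implies_permutes[of "{..<m}" "count M" "count M'"] by auto
  have px: "count M x = count M' (p x)" for x
  proof (cases "x \<in> {..<m}")
    case False
    then have "x \<notin># M" "x \<notin># M'" "p x = x" using m permutes_not_in[OF p(1)] by auto
    then show ?thesis by (simp add: not_in_iff)
  qed (use p(2) in blast)
  have bij: "bij p" using p(1) by (rule permutes_bij)
  have "image_mset p M = M'"
  proof (rule multiset_eqI)
    fix y
    obtain x where y: "y = p x" using bij by (metis bij_pointE)
    have "p -` {y} = {x}" using bij by (auto simp: y bij_def inj_def)
    then have "count (image_mset p M) y = count M x"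
      by (cases "x \<in># M") (auto simp: count_image_mset not_in_iff)
    then show "count (image_mset p M) y = count M' y" by (simp add: px y)
  qed
  moreover have "mcoeff f (image_mset p M) = mcoeff f M" using f bij by (simp add: Sym_def)
  ultimately show ?thesis by simp
qed

lemma Sym_bounded:
  assumes "f \<in> Sym"
  obtains d where "\<And>M. mcoeff f M \<noteq> 0 \<Longrightarrow> size M \<le> d"
  using assms unfolding Sym_def by blast

text \<open>The monomial with exponent \<open>row \<mu> i\<close> in variable \<open>i\<close>. Its
  exponents decrease, so the dominance inequality for tableau contents compares
  \<open>row \<mu>\<close> with the row lengths of the shape.\<close>

definition rep_monomial :: "nat multiset \<Rightarrow> nat multiset" where
  "rep_monomial \<mu> = Abs_multiset (row \<mu>)"

lemma count_rep_monomial: "count (rep_monomial \<mu>) = row \<mu>"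
  unfolding rep_monomial_def
  by (rule count_Abs_multiset) (use finite_shape_nonzero[OF shape_row] in simp)

lemma exponents_rep_monomial: "partition \<mu> \<Longrightarrow> exponents (rep_monomial \<mu>) = \<mu>"
proof -
  assume \<mu>: "partition \<mu>"
  have "set_mset (rep_monomial \<mu>) = {i. row \<mu> i \<noteq> 0}"
    by (simp flip: count_rep_monomial)
  then have "exponents (rep_monomial \<mu>) = partition_of_row (row \<mu>)"
    unfolding exponents_def partition_of_row_def count_rep_monomial by simp
  then show ?thesis by (simp only: partition_of_row_row[OF \<mu>])
qed

lemma size_rep_monomial: "partition \<mu> \<Longrightarrow> size (rep_monomial \<mu>) = \<Sum>\<^sub># \<mu>"
  by (metis exponents_rep_monomial sum_exponents)

lemma finite_partitions_of: "finite {\<mu>. partition_of n \<mu>}"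
  using bij_betw_finite[OF bij_betw_row] finite_shapes by blast

lemma finite_partitions_le: "finite {\<mu>. partition \<mu> \<and> \<Sum>\<^sub># \<mu> \<le> d}"
proof -
  have "{\<mu>. partition \<mu> \<and> \<Sum>\<^sub># \<mu> \<le> d} = (\<Union>n\<le>d. {\<mu>. partition_of n \<mu>})"
    by (auto simp: partition_of_def)
  then show ?thesis by (simp add: finite_partitions_of)
qed

section \<open>The Schur basis\<close>

text \<open>Elimination from the top: the values of \<open>F\<close> on the highest remaining rank
  serve as coefficients, and subtracting their contribution clears that rank and changes only lower
  ones.\<close>

lemma unitriangular_surj:
  fixes A :: "'i \<Rightarrow> 'i \<Rightarrow> 'a::comm_ring_1" and rank :: "'i \<Rightarrow> nat"
  assumes fin: "finite P" and diag: "\<And>p. p \<in> P \<Longrightarrow> A p p = 1"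
    and tri: "\<And>p q. p \<in> P \<Longrightarrow> q \<in> P \<Longrightarrow> A p q \<noteq> 0 \<Longrightarrow> p = q \<or> rank q < rank p"
  shows "\<exists>c. \<forall>q\<in>P. F q = (\<Sum>p\<in>P. c p * A p q)"
proof -
  have bounded: "\<exists>c. \<forall>q\<in>P. F q = (\<Sum>p\<in>P. c p * A p q)" if "\<And>q. q \<in> P \<Longrightarrow> F q \<noteq> 0 \<Longrightarrow> rank q < n" for F n
    using that
  proof (induction n arbitrary: F)
    case 0
    then have "\<forall>q\<in>P. F q = (\<Sum>p\<in>P. 0 * A p q)" by auto
    then show ?case by (rule exI[of _ "\<lambda>_. 0"])
  next
    case (Suc n)
    define c0 where "c0 = (\<lambda>p. if rank p = n then F p else 0)"
    define F' where "F' = (\<lambda>q. F q - (\<Sum>p\<in>P. c0 p * A p q))"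
    have "rank q < n" if q: "q \<in> P" "F' q \<noteq> 0" for q
    proof (rule ccontr)
      assume n: "\<not> rank q < n"
      have "(\<Sum>p\<in>P. c0 p * A p q) = (\<Sum>p\<in>P. if p = q then c0 q else 0)"
      proof (rule sum.cong)
        fix p assume p: "p \<in> P"
        show "c0 p * A p q = (if p = q then c0 q else 0)"
        proof (cases "p = q")
          case False
          then have "A p q = 0 \<or> rank p > n" using tri[OF p q(1)] n by fastforce
          with False show ?thesis by (auto simp: c0_def)
        qed (simp add: diag q)
      qed simp
      also have "\<dots> = c0 q" using fin q by simp
      also have "\<dots> = F q" using Suc.prems[OF q(1)] n by (cases "F q = 0") (auto simp: c0_def)
      finally show False using q(2) by (simp add: F'_def)
    qed
    from Suc.IH[OF this] obtain c where c: "\<forall>q\<in>P. F' q = (\<Sum>p\<in>P. c p * A p q)" by blast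
    have "F q = (\<Sum>p\<in>P. (c0 p + c p) * A p q)" if "q \<in> P" for q
    proof -
      have "F q = F' q + (\<Sum>p\<in>P. c0 p * A p q)" by (simp add: F'_def)
      with c that show ?thesis by (simp add: distrib_right sum.distrib add.commute)
    qed
    then show ?case by (intro exI[of _ "\<lambda>p. c0 p + c p"] ballI)
  qed
  have "rank q < Suc (Max (insert 0 (rank ` P)))" if "q \<in> P" for q
    using subset_lessThan_Suc_Max[of "rank ` P"] fin that by auto
  then show ?thesis by (rule bounded)
qed

text \<open>Evaluate at an index \<open>q\<close> of maximal rank in the support of
  \<open>c\<close>: another contributing index would have larger rank, so only the diagonal term
  \<open>c q\<close> survives.\<close>

lemma unitriangular_inj:
  fixes A :: "'i \<Rightarrow> 'i \<Rightarrow> 'a::comm_ring_1" and rank :: "'i \<Rightarrow> nat"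
  assumes fin: "finite P" and diag: "\<And>p. p \<in> P \<Longrightarrow> A p p = 1"
    and tri: "\<And>p q. p \<in> P \<Longrightarrow> q \<in> P \<Longrightarrow> A p q \<noteq> 0 \<Longrightarrow> p = q \<or> rank q < rank p"
    and zero: "\<And>q. q \<in> P \<Longrightarrow> (\<Sum>p\<in>P. c p * A p q) = 0" and p: "p \<in> P"
  shows "c p = 0"
proof (rule ccontr)
  define S where "S = {p \<in> P. c p \<noteq> 0}"
  assume "c p \<noteq> 0"
  with p fin have "finite (rank ` S)" "rank ` S \<noteq> {}" by (auto simp: S_def)
  from Max_in[OF this] obtain q where q: "q \<in> S" "rank q = Max (rank ` S)" by force
  have max: "rank p \<le> rank q" if "p \<in> S" for p
    using that q(2) Max_ge[OF \<open>finite (rank ` S)\<close>] by auto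
  have "(\<Sum>p\<in>P. c p * A p q) = (\<Sum>p\<in>P. if p = q then c q else 0)"
  proof (rule sum.cong)
    fix p assume p: "p \<in> P"
    show "c p * A p q = (if p = q then c q else 0)"
    proof (cases "p = q")
      case False
      then have "A p q = 0 \<or> p \<notin> S" using tri[OF p, of q] max[of p] q(1) by (fastforce simp: S_def)
      with False p show ?thesis by (auto simp: S_def)
    qed (use q diag in \<open>simp add: S_def\<close>)
  qed simp
  also have "\<dots> = c q" using fin q by (simp add: S_def)
  finally show False using zero[of q] q(1) by (simp add: S_def)
qed

section \<open>Dominance order and Schur expansions\<close>

text \<open>Adding up all partial sums turns dominance into a comparison of numbers, strict for
  distinct partitions; \<open>d\<close> bounds the weights, hence the number of rows.\<close>

definition dominance_rank :: "nat \<Rightarrow> nat multiset \<Rightarrow> nat" where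
  "dominance_rank d \<mu> = (\<Sum>k\<le>d. sum (row \<mu>) {..<k})"

lemma row_eq_0:
  assumes "\<Sum>\<^sub># \<mu> \<le> d" "i \<ge> d" shows "row \<mu> i = 0"
  using shapes_bounds(2)[of "row \<mu>" "\<Sum>\<^sub># \<mu>" i] assms by (simp add: shapes_def shape_row weight_row)

lemma card_ssyt_rep_monomial:
  assumes "\<Sum>\<^sub># \<mu> \<le> d"
  shows "card (ssyt l (rep_monomial \<mu>)) = kostka (row \<mu>) d (row l)"
proof -
  have "set_mset (rep_monomial \<mu>) \<subseteq> {..<d}"
  proof
    fix i assume "i \<in># rep_monomial \<mu>"
    then have "row \<mu> i \<noteq> 0" by (simp flip: count_rep_monomial)
    with row_eq_0[OF assms, of i] show "i \<in> {..<d}" by (cases "d \<le> i") auto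
  qed
  then show ?thesis using card_ssyt count_rep_monomial by metis
qed

lemma card_ssyt_self: "card (ssyt \<mu> (rep_monomial \<mu>)) = 1"
  unfolding card_ssyt_rep_monomial[OF order_refl]
  by (rule kostka_self[OF shape_row]) (rule row_eq_0[OF order_refl])

text \<open>A tableau forces an inequality between all prefix sums. Equal ranks turn each of them
  into an equality, and row lengths are differences of successive prefix sums.\<close>

lemma card_ssyt_triangular:
  assumes p: "partition l" "partition \<mu>" and d: "\<Sum>\<^sub># l \<le> d" "\<Sum>\<^sub># \<mu> \<le> d"
    and nz: "card (ssyt l (rep_monomial \<mu>)) \<noteq> 0"
  shows "l = \<mu> \<or> dominance_rank d \<mu> < dominance_rank d l"
proof -
  have nz': "kostka (row \<mu>) d (row l) \<noteq> 0" using nz card_ssyt_rep_monomial[OF d(2)] by simp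
  have le: "sum (row \<mu>) {..<k} \<le> sum (row l) {..<k}" if "k \<in> {..d}" for k
    using kostka_nonzeroD(4)[OF nz'] that by simp
  then have "dominance_rank d \<mu> \<le> dominance_rank d l"
    unfolding dominance_rank_def by (rule sum_mono)
  moreover have "l = \<mu>" if "dominance_rank d \<mu> = dominance_rank d l"
  proof -
    have eq: "sum (row \<mu>) {..<k} = sum (row l) {..<k}" if "k \<le> d" for k
      using sum_mono_inv[OF \<open>dominance_rank d \<mu> = dominance_rank d l\<close>[unfolded dominance_rank_def] le, of k] that
      by simp
    have "row \<mu> i = row l i" for i
      using eq[of i] eq[of "Suc i"] row_eq_0[OF d(1), of i] row_eq_0[OF d(2), of i] by (cases "i < d") auto
    then have "row \<mu> = row l" by blast
    then show ?thesis using partition_of_row_row[OF p(1)] partition_of_row_row[OF p(2)] by simp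
  qed
  ultimately show ?thesis by (metis le_neq_implies_less)
qed

lemma schur_basis_inj:
  fixes c :: "nat multiset \<Rightarrow> 'a::comm_ring_1"
  assumes fin: "finite P" and part: "\<And>\<mu>. \<mu> \<in> P \<Longrightarrow> partition \<mu>"
    and eq: "(\<Sum>\<mu>\<in>P. scale (c \<mu>) (schur \<mu>)) = (\<Sum>\<mu>\<in>P. scale (c' \<mu>) (schur \<mu>))" and \<mu>: "\<mu> \<in> P"
  shows "c \<mu> = c' \<mu>"
proof -
  obtain d where d: "sum_mset ` P \<subseteq> {..d}" using fin finite_nat_iff_bounded_le by blast
  let ?A = "\<lambda>l \<mu>. of_nat (card (ssyt l (rep_monomial \<mu>))) :: 'a"
  have "c \<mu> - c' \<mu> = 0"
  proof (rule unitriangular_inj[OF fin, where A = ?A and rank = "dominance_rank d" and c = "\<lambda>\<mu>. c \<mu> - c' \<mu>"])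
    fix q
    have "(\<Sum>p\<in>P. c p * ?A p q) = (\<Sum>p\<in>P. c' p * ?A p q)"
      using arg_cong[OF eq, of "\<lambda>f. mcoeff f (rep_monomial q)"] by (simp add: mcoeff_sum mcoeff_schur)
    then show "(\<Sum>p\<in>P. (c p - c' p) * ?A p q) = 0"
      by (simp add: left_diff_distrib sum_subtractf)
  next
    fix p q assume "p \<in> P" "q \<in> P" "?A p q \<noteq> 0"
    then show "p = q \<or> dominance_rank d q < dominance_rank d p"
      by (intro card_ssyt_triangular) (use part d in \<open>auto simp del: card_0_eq intro: ccontr\<close>)
  qed (simp_all add: card_ssyt_self \<mu>)
  then show ?thesis by simp
qed

lemma sum_scale_support:
  assumes "finite P" "{\<mu>. c \<mu> \<noteq> 0} \<subseteq> P"
  shows "(\<Sum>\<mu> | c \<mu> \<noteq> 0. scale (c \<mu>) (b \<mu>)) = (\<Sum>\<mu>\<in>P. scale (c \<mu>) (b \<mu>))"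
  by (rule sum.mono_neutral_left) (use assms in \<open>auto simp: mseries_eq_iff\<close>)

text \<open>Since \<open>coords\<close> is a definite description, a given expansion identifies it
  only through uniqueness, obtained by comparing two expansions over the union \<open>Q\<close> of
  their index sets.\<close>

lemma coords_schurI:
  fixes f :: "'a::comm_ring_1 mseries"
  assumes fin: "finite P" and part: "\<And>\<mu>. \<mu> \<in> P \<Longrightarrow> partition \<mu>"
    and supp: "\<And>\<mu>. c \<mu> \<noteq> 0 \<Longrightarrow> \<mu> \<in> P"
    and f: "f = (\<Sum>\<mu>\<in>P. scale (c \<mu>) (schur \<mu>))"
  shows "coords schur f = c"
  unfolding coords_def
proof (rule the_equality)
  have supp': "{\<mu>. c \<mu> \<noteq> 0} \<subseteq> P" using supp by blast
  show "finite {\<mu>. c \<mu> \<noteq> 0} \<and> (\<forall>\<mu>. c \<mu> \<noteq> 0 \<longrightarrow> partition \<mu>) \<and> f = (\<Sum>\<mu> | c \<mu> \<noteq> 0. scale (c \<mu>) (schur \<mu>))"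
    using finite_subset[OF supp' fin] part supp sum_scale_support[OF fin supp'] f by auto
  fix c' assume c': "finite {\<mu>. c' \<mu> \<noteq> 0} \<and> (\<forall>\<mu>. c' \<mu> \<noteq> 0 \<longrightarrow> partition \<mu>) \<and>
      f = (\<Sum>\<mu> | c' \<mu> \<noteq> 0. scale (c' \<mu>) (schur \<mu>))"
  define Q where "Q = P \<union> {\<mu>. c' \<mu> \<noteq> 0}"
  have Q: "finite Q" "{\<mu>. c \<mu> \<noteq> 0} \<subseteq> Q" "{\<mu>. c' \<mu> \<noteq> 0} \<subseteq> Q" "\<And>\<mu>. \<mu> \<in> Q \<Longrightarrow> partition \<mu>"
    using fin c' supp part by (auto simp: Q_def)
  have "f = (\<Sum>\<mu>\<in>Q. scale (c \<mu>) (schur \<mu>))"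
    using sum_scale_support[OF Q(1,2), of schur] sum_scale_support[OF fin supp', of schur] f by simp
  moreover have "f = (\<Sum>\<mu>\<in>Q. scale (c' \<mu>) (schur \<mu>))"
    using sum_scale_support[OF Q(1,3), of schur] c' by simp
  ultimately have "c' \<mu> = c \<mu>" if "\<mu> \<in> Q" for \<mu>
    using schur_basis_inj[OF Q(1,4), of c' c \<mu>] that by simp
  moreover have "c' \<mu> = c \<mu>" if "\<mu> \<notin> Q" for \<mu>
  proof -
    have "c' \<mu> = 0" "c \<mu> = 0" using that Q(2,3) by blast+
    then show ?thesis by simp
  qed
  ultimately show "c' = c" by blast
qed

text \<open>The values at the monomials \<open>rep_monomial \<mu>\<close> of degree at most
  \<open>d\<close> give a unitriangular system for the coefficients. Symmetry of \<open>f\<close>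
  and of the tableau counts carries the identity to every monomial of degree at most
  \<open>d\<close>; beyond \<open>d\<close> both sides vanish.\<close>

lemma Sym_schur_expansion:
  fixes f :: "'a::comm_ring_1 mseries"
  assumes f: "f \<in> Sym"
  obtains P c where "finite P" "\<And>\<mu>. \<mu> \<in> P \<Longrightarrow> partition \<mu>" "\<And>\<mu>. c \<mu> \<noteq> 0 \<Longrightarrow> \<mu> \<in> P"
    "f = (\<Sum>\<mu>\<in>P. scale (c \<mu>) (schur \<mu>))"
proof -
  obtain d where d: "\<And>M. mcoeff f M \<noteq> 0 \<Longrightarrow> size M \<le> d" using Sym_bounded[OF f] by blast
  define P where "P = {\<mu>. partition \<mu> \<and> \<Sum>\<^sub># \<mu> \<le> d}"
  have fin: "finite P" unfolding P_def by (rule finite_partitions_le)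
  let ?A = "\<lambda>l \<mu>. of_nat (card (ssyt l (rep_monomial \<mu>))) :: 'a"
  have "\<exists>c. \<forall>\<mu>\<in>P. mcoeff f (rep_monomial \<mu>) = (\<Sum>l\<in>P. c l * ?A l \<mu>)"
  proof (rule unitriangular_surj[OF fin, where rank = "dominance_rank d"])
    fix p q assume "p \<in> P" "q \<in> P" "?A p q \<noteq> 0"
    then show "p = q \<or> dominance_rank d q < dominance_rank d p"
      by (intro card_ssyt_triangular) (auto simp: P_def simp del: card_0_eq intro: ccontr)
  qed (simp add: card_ssyt_self)
  then obtain c where c: "\<And>\<mu>. \<mu> \<in> P \<Longrightarrow> mcoeff f (rep_monomial \<mu>) = (\<Sum>l\<in>P. c l * ?A l \<mu>)" by blast
  define c' where "c' = (\<lambda>\<mu>. if \<mu> \<in> P then c \<mu> else 0)"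
  have "mcoeff f M = (\<Sum>l\<in>P. c l * of_nat (card (ssyt l M)))" for M
  proof (cases "size M \<le> d")
    case True
    let ?\<mu> = "exponents M"
    have \<mu>: "?\<mu> \<in> P" using True by (simp add: P_def partition_exponents sum_exponents)
    have e: "exponents M = exponents (rep_monomial ?\<mu>)"
      by (simp add: exponents_rep_monomial partition_exponents)
    show ?thesis using c[OF \<mu>] Sym_mcoeff_eq[OF f e] card_ssyt_symmetric[OF e] by simp
  next
    case False
    have "card (ssyt l M) = 0" if "l \<in> P" for l
    proof (rule ccontr)
      assume nz: "card (ssyt l M) \<noteq> 0"
      let ?m = "Suc (Max (insert 0 (set_mset M)))"
      have m: "set_mset M \<subseteq> {..<?m}" by (rule subset_lessThan_Suc_Max) simp
      have "\<Sum>\<^sub># l = sum (count M) {..<?m}"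
        using nz kostka_nonzeroD(2) by (metis card_ssyt[OF m] weight_row)
      also have "\<dots> = size M"
        unfolding size_multiset_overloaded_eq using m
        by (intro sum.mono_neutral_right) (auto simp: not_in_iff)
      finally show False using False that by (simp add: P_def)
    qed
    moreover have "mcoeff f M = 0" using d False by blast
    ultimately show ?thesis by simp
  qed
  then have "f = (\<Sum>\<mu>\<in>P. scale (c' \<mu>) (schur \<mu>))"
    by (simp add: mseries_eq_iff mcoeff_sum mcoeff_schur c'_def)
  then show ?thesis by (rule that[OF fin, rotated 2]) (auto simp: P_def c'_def split: if_splits)
qed

section \<open>Powers of h_1 and the Hall pairing\<close>

text \<open>The factors of \<open>M\<close> of degree one are its distinct variables, so the sum
  runs over \<open>set_mset M\<close> without multiplicity.\<close>

lemma mcoeff_homogeneous_1_times: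
  "mcoeff (complete_homogeneous 1 * f) M = (\<Sum>x\<in>set_mset M. mcoeff f (M - {#x#}))"
proof -
  have "mcoeff (complete_homogeneous 1 * f) M =
        (\<Sum>z\<in>{(A, B). A + B = M}. (if size (fst z) = 1 then 1 else 0) * mcoeff f (snd z))"
    by (simp add: times_mseries.rep_eq complete_homogeneous_def case_prod_beta)
  also have "\<dots> = (\<Sum>z\<in>(\<lambda>x. ({#x#}, M - {#x#})) ` set_mset M.
       (if size (fst z) = 1 then 1 else 0) * mcoeff f (snd z))"
  proof (rule sum.mono_neutral_right)
    show "\<forall>z\<in>{(A, B). A + B = M} - (\<lambda>x. ({#x#}, M - {#x#})) ` set_mset M.
        (if size (fst z) = 1 then 1 else 0) * mcoeff f (snd z) = 0"
    proof
      fix z assume z: "z \<in> {(A, B). A + B = M} - (\<lambda>x. ({#x#}, M - {#x#})) ` set_mset M"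
      have "size (fst z) \<noteq> 1"
      proof
        assume "size (fst z) = 1"
        then obtain x where "fst z = {#x#}" using size_1_singleton_mset by blast
        with z have "M = add_mset x (snd z)" "z = ({#x#}, snd z)" by (auto simp: prod_eq_iff)
        with z show False by (auto simp: image_iff)
      qed
      then show "(if size (fst z) = 1 then 1 else 0) * mcoeff f (snd z) = 0" by simp
    qed
  qed (auto simp: finite_msplit)
  also have "\<dots> = (\<Sum>x\<in>set_mset M. mcoeff f (M - {#x#}))"
    by (subst sum.reindex) (auto simp: inj_on_def)
  finally show ?thesis .
qed

lemma mcoeff_homogeneous_1_power:
  assumes "set_mset M \<subseteq> {..<m}"
  shows "mcoeff (complete_homogeneous 1 ^ n) M =
    (of_nat (\<Sum>l\<in>shapes n. kostka (\<lambda>_. 1) n l * kostka (count M) m l) :: 'a::comm_ring_1)"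
  using assms
proof (induction n arbitrary: M)
  case 0
  have "shapes 0 = {\<lambda>_. 0}" using shapes_bounds(2)[of _ 0] by (auto simp: shapes_def weight_def)
  moreover have "kostka (count M) m (\<lambda>_. 0) = of_bool (M = {#})"
  proof (cases "M = {#}")
    case True
    then have "count M = (\<lambda>_. 0)" by auto
    with True show ?thesis using kostka_self[of "\<lambda>_. 0" m] by simp
  next
    case False
    then obtain x where "x \<in># M" by blast
    then have "count M x \<le> sum (count M) {..<m}" using 0 by (intro member_le_sum) auto
    moreover have "count M x > 0" using \<open>x \<in># M\<close> by simp
    ultimately have "sum (count M) {..<m} \<noteq> 0" by linarith
    then have "weight (\<lambda>_. 0) \<noteq> sum (count M) {..<m}" by (simp add: weight_def)
    then have "kostka (count M) m (\<lambda>_. 0) = 0" using kostka_nonzeroD(2) by blast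
    with False show ?thesis by simp
  qed
  ultimately show ?case by (simp add: one_mseries.rep_eq)
next
  case (Suc n)
  let ?G = "kostka (count M) m"
  have upd: "count (M - {#x#}) = (count M)(x := count M x - 1)" for x by (auto simp: fun_eq_iff)
  have set: "{i. i < m \<and> count M i > 0} = set_mset M" using Suc.prems by (auto simp: subset_iff)
  have "(mcoeff (complete_homogeneous 1 ^ Suc n) M :: 'a) =
      (\<Sum>x\<in>set_mset M. mcoeff (complete_homogeneous 1 ^ n) (M - {#x#}))"
    by (simp only: power_Suc mcoeff_homogeneous_1_times)
  also have "\<dots> = of_nat (\<Sum>x\<in>set_mset M. \<Sum>l\<in>shapes n. kostka (\<lambda>_. 1) n l * kostka (count (M - {#x#})) m l)"
    unfolding of_nat_sum[of _ "set_mset M"]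
  proof (rule sum.cong)
    fix x
    have "set_mset (M - {#x#}) \<subseteq> {..<m}" using Suc.prems by (auto dest: in_diffD)
    then show "(mcoeff (complete_homogeneous 1 ^ n) (M - {#x#}) :: 'a) =
      of_nat (\<Sum>l\<in>shapes n. kostka (\<lambda>_. 1) n l * kostka (count (M - {#x#})) m l)" by (rule Suc.IH)
  qed simp
  also have "(\<Sum>x\<in>set_mset M. \<Sum>l\<in>shapes n. kostka (\<lambda>_. 1) n l * kostka (count (M - {#x#})) m l) =
      (\<Sum>l\<in>shapes n. kostka (\<lambda>_. 1) n l * (\<Sum>x\<in>set_mset M. kostka (count (M - {#x#})) m l))"
    by (subst sum.swap) (simp add: sum_distrib_left)
  also have "\<dots> = (\<Sum>l\<in>shapes n. kostka (\<lambda>_. 1) n l * sum_box_up ?G l)"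
    unfolding upd set[symmetric]
    by (intro sum.cong) (simp_all add: kostka_Pieri shapes_def)
  also have "\<dots> = (\<Sum>l\<in>shapes (Suc n). kostka (\<lambda>_. 1) (Suc n) l * ?G l)"
    by (rule sum_kostka_box_up[symmetric])
  finally show ?case .
qed

lemma homogeneous_1_power_expansion:
  "complete_homogeneous 1 ^ n =
   (\<Sum>\<mu> | partition_of n \<mu>. scale (of_nat (kostka (\<lambda>_. 1) n (row \<mu>))) (schur \<mu>) :: 'a::comm_ring_1 mseries)"
  unfolding mseries_eq_iff
proof
  fix M
  define m where "m = Suc (Max (insert 0 (set_mset M)))"
  have m: "set_mset M \<subseteq> {..<m}" unfolding m_def by (rule subset_lessThan_Suc_Max) simp
  have "mcoeff (complete_homogeneous 1 ^ n) M =
      (of_nat (\<Sum>\<mu> | partition_of n \<mu>. kostka (\<lambda>_. 1) n (row \<mu>) * kostka (count M) m (row \<mu>)) :: 'a)"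
    unfolding mcoeff_homogeneous_1_power[OF m]
    by (subst sum.reindex_bij_betw[OF bij_betw_row, symmetric]) simp
  then show "mcoeff (complete_homogeneous 1 ^ n) M = mcoeff (\<Sum>\<mu> | partition_of n \<mu>. scale (of_nat (kostka (\<lambda>_. 1) n (row \<mu>))) (schur \<mu>) :: 'a mseries) M"
    by (simp add: mcoeff_sum mcoeff_schur card_ssyt[OF m])
qed

lemma hall_homogeneous_1_power:
  fixes f :: "'a::comm_ring_1 mseries"
  assumes "f \<in> Sym"
  shows "hall f (complete_homogeneous 1 ^ n) = mcoeff f (mset_set {..<n})"
proof -
  obtain P c where P: "finite P" "\<And>\<mu>. \<mu> \<in> P \<Longrightarrow> partition \<mu>" "\<And>\<mu>. c \<mu> \<noteq> 0 \<Longrightarrow> \<mu> \<in> P"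
    and f: "f = (\<Sum>\<mu>\<in>P. scale (c \<mu>) (schur \<mu>))"
    using Sym_schur_expansion[OF assms] by blast
  define h where "h = (\<lambda>\<mu>. if partition_of n \<mu> then of_nat (kostka (\<lambda>_. 1) n (row \<mu>)) else (0::'a))"
  have cf: "coords schur f = c" using coords_schurI[OF P f] .
  have ch: "coords schur (complete_homogeneous 1 ^ n) = h"
  proof (rule coords_schurI[OF finite_partitions_of[of n]])
    show "complete_homogeneous 1 ^ n = (\<Sum>\<mu> | partition_of n \<mu>. scale (h \<mu>) (schur \<mu>))"
      unfolding homogeneous_1_power_expansion by (rule sum.cong) (simp_all add: h_def)
  qed (auto simp: h_def partition_of_def split: if_splits)
  have h: "h \<mu> = mcoeff (schur \<mu>) (mset_set {..<n})" if "partition \<mu>" for \<mu>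
  proof -
    \<comment> \<open>The monomial x_0 ... x_(n-1) has multiplicity 1 at every letter below
      \<open>n\<close>, so its tableaux are the standard ones counted by the coefficients
      \<open>h\<close>.\<close>
    have "kostka (count (mset_set {..<n})) n = kostka (\<lambda>_. 1) n"
      by (rule kostka_cong) simp
    then have *: "card (ssyt \<mu> (mset_set {..<n})) = kostka (\<lambda>_. 1) n (row \<mu>)"
      using card_ssyt[of "mset_set {..<n}" n \<mu>] by simp
    show ?thesis
    proof (cases "\<Sum>\<^sub># \<mu> = n")
      case False
      then have "kostka (\<lambda>_. 1) n (row \<mu>) = 0"
        using kostka_nonzeroD(2)[of "\<lambda>_. 1" n "row \<mu>"] by (auto simp: weight_row)
      with * False show ?thesis by (simp add: h_def mcoeff_schur partition_of_def)
    qed (use * that in \<open>simp add: h_def mcoeff_schur partition_of_def\<close>)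
  qed
  have "hall f (complete_homogeneous 1 ^ n) = (\<Sum>\<mu> | c \<mu> \<noteq> 0. c \<mu> * h \<mu>)"
    by (simp only: hall_def diag_form_def cf ch mult_1_right)
  also have "\<dots> = (\<Sum>\<mu>\<in>P. c \<mu> * h \<mu>)"
    by (rule sum.mono_neutral_left) (use P in auto)
  also have "\<dots> = mcoeff f (mset_set {..<n})"
    by (simp add: f mcoeff_sum h P(2))
  finally show ?thesis .
qed

section \<open>The monomial basis and Jack functions\<close>

lemma mcoeff_monomial_sf: "mcoeff (monomial_sf \<mu>) M = (if exponents M = \<mu> then 1 else 0)"
  by (simp add: monomial_sf_def)

lemma mcoeff_sum_monomial_sf:
  assumes "finite {\<mu>. c \<mu> \<noteq> 0}"
  shows "mcoeff (\<Sum>\<mu> | c \<mu> \<noteq> 0. scale (c \<mu>) (monomial_sf \<mu>)) M = c (exponents M)"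
proof -
  have "mcoeff (\<Sum>\<mu> | c \<mu> \<noteq> 0. scale (c \<mu>) (monomial_sf \<mu>)) M =
        (\<Sum>\<mu> | c \<mu> \<noteq> 0. if exponents M = \<mu> then c \<mu> else 0)"
    unfolding mcoeff_sum by (rule sum.cong) (simp_all add: mcoeff_monomial_sf)
  then show ?thesis using assms by simp
qed

text \<open>Each monomial occurs in exactly one monomial symmetric function, so any expansion has
  its coefficients prescribed one at a time by the values of \<open>f\<close>.\<close>

lemma coords_monomial_sf:
  fixes f :: "'a::comm_ring_1 mseries"
  assumes f: "f \<in> Sym"
  shows "coords monomial_sf f (exponents M) = mcoeff f M"
proof -
  obtain d where d: "\<And>M. mcoeff f M \<noteq> 0 \<Longrightarrow> size M \<le> d" using Sym_bounded[OF f] by blast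
  define c where "c = (\<lambda>\<mu>. if partition \<mu> then mcoeff f (rep_monomial \<mu>) else 0)"
  have c: "c (exponents M) = mcoeff f M" for M
    using Sym_mcoeff_eq[OF f, of "rep_monomial (exponents M)" M]
    by (simp add: c_def partition_exponents exponents_rep_monomial)
  have fin: "finite {\<mu>. c \<mu> \<noteq> 0}"
  proof (rule finite_subset[OF _ finite_partitions_le])
    show "{\<mu>. c \<mu> \<noteq> 0} \<subseteq> {\<mu>. partition \<mu> \<and> \<Sum>\<^sub># \<mu> \<le> d}"
      using d by (auto simp: c_def size_rep_monomial[symmetric])
  qed
  have "coords monomial_sf f = c"
    unfolding coords_def
  proof (rule the_equality)
    show "finite {\<mu>. c \<mu> \<noteq> 0} \<and> (\<forall>\<mu>. c \<mu> \<noteq> 0 \<longrightarrow> partition \<mu>) \<and>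
        f = (\<Sum>\<mu> | c \<mu> \<noteq> 0. scale (c \<mu>) (monomial_sf \<mu>))"
    proof (intro conjI allI impI)
      show "f = (\<Sum>\<mu> | c \<mu> \<noteq> 0. scale (c \<mu>) (monomial_sf \<mu>))"
        unfolding mseries_eq_iff mcoeff_sum_monomial_sf[OF fin] by (simp only: c simp_thms)
      show "partition \<mu>" if "c \<mu> \<noteq> 0" for \<mu>
        using that unfolding c_def by (meson)
    qed (rule fin)
    fix c' assume c': "finite {\<mu>. c' \<mu> \<noteq> 0} \<and> (\<forall>\<mu>. c' \<mu> \<noteq> 0 \<longrightarrow> partition \<mu>) \<and>
        f = (\<Sum>\<mu> | c' \<mu> \<noteq> 0. scale (c' \<mu>) (monomial_sf \<mu>))"
    have "c' \<mu> = c \<mu>" for \<mu>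
    proof (cases "partition \<mu>")
      case True
      have "mcoeff f (rep_monomial \<mu>) = c' (exponents (rep_monomial \<mu>))"
        using c' mcoeff_sum_monomial_sf[of c' "rep_monomial \<mu>"] by simp
      with True show ?thesis by (simp add: c_def exponents_rep_monomial)
    next
      case False
      then have "c' \<mu> = 0" "c \<mu> = 0" using c' by (blast, simp add: c_def)
      then show ?thesis by simp
    qed
    then show "c' = c" by blast
  qed
  with c show ?thesis by simp
qed

lemma exponents_mset_set: "finite A \<Longrightarrow> exponents (mset_set A) = replicate_mset (card A) 1"
proof -
  assume A: "finite A"
  then have "exponents (mset_set A) = image_mset (\<lambda>_. 1) (mset_set A)"
    by (auto simp: exponents_def intro!: image_mset_cong)
  then show ?thesis by (simp add: image_mset_const_eq)
qed

text \<open>The description ranges over all fractions representing the constant. Each has numerator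
  \<open>k\<close> times its denominator, hence value \<open>k\<close> wherever the denominator does
  not vanish; \<open>k / 1\<close> is one of them.\<close>

lemma subst_alpha_of_nat: "subst_alpha \<beta> (of_nat k) = of_nat k"
  unfolding subst_alpha_def
proof (rule the_equality)
  have const: "map_poly of_rat (of_nat k :: rat poly) = (of_nat k :: rat_fun poly)"
    by (rule poly_eqI) (simp add: coeff_map_poly of_nat_poly coeff_pCons split: nat.split)
  show "\<exists>p q. (of_nat k :: rat_fun) = Fract p q \<and> poly (map_poly of_rat q) \<beta> \<noteq> 0 \<and>
      of_nat k = poly (map_poly of_rat p) \<beta> / poly (map_poly of_rat q) \<beta>"
    by (intro exI[of _ "of_nat k"] exI[of _ 1]) (simp add: Fract_of_nat_eq const)
  fix y assume "\<exists>p q. (of_nat k :: rat_fun) = Fract p q \<and> poly (map_poly of_rat q) \<beta> \<noteq> 0 \<and>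
      y = poly (map_poly of_rat p) \<beta> / poly (map_poly of_rat q) \<beta>"
  then obtain p q where pq: "(of_nat k :: rat_fun) = Fract p q" "poly (map_poly of_rat q) \<beta> \<noteq> 0"
    "y = poly (map_poly of_rat p) \<beta> / poly (map_poly of_rat q) \<beta>" by blast
  then have "q \<noteq> 0" by auto
  with pq(1) have "p = smult (of_nat k) q"
    by (simp add: of_nat_fract eq_fract of_nat_poly)
  then have "map_poly of_rat p = smult (of_nat k) (map_poly of_rat q :: rat_fun poly)"
    by (simp add: map_poly_smult of_rat_mult)
  with pq show "y = of_nat k" by simp
qed

lemma jack_tilde_Sym:
  assumes "J \<mu> \<in> Sym" shows "jack_tilde J \<mu> \<in> Sym"
proof -
  obtain d where d: "\<And>M. mcoeff (J \<mu>) M \<noteq> 0 \<Longrightarrow> size M \<le> d" using Sym_bounded[OF assms] by blast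
  \<comment> \<open>Substitution acts on each coefficient, so symmetry is kept; bounded degree is
    kept because a zero coefficient stays zero.\<close>
  have "subst_alpha (1 / alpha) 0 = 0" using subst_alpha_of_nat[of _ 0] by simp
  with d have "size M \<le> d" if "mcoeff (jack_tilde J \<mu>) M \<noteq> 0" for M
    using that by (cases "mcoeff (J \<mu>) M = 0") (auto simp: jack_tilde_def)
  with assms show ?thesis by (auto simp: Sym_def jack_tilde_def)
qed

theorem proposition3p1:
  fixes J :: "nat multiset \<Rightarrow> rat_fun mseries" and n :: nat and \<mu> :: "nat multiset"
  assumes "jack_family J" and "n \<ge> 1" and "partition_of n \<mu>"
  shows "coords monomial_sf (jack_tilde J \<mu>) (replicate_mset n 1)
           = hall (jack_tilde J \<mu>) (complete_sf (replicate_mset n 1)) \<and>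
         hall (jack_tilde J \<mu>) (complete_sf (replicate_mset n 1)) = fact n * alpha ^ n \<and>
         fact n * alpha ^ n
           = (\<Sum>k = 0..n - 1. fact n * of_nat (eulerian n k) * ((alpha + of_nat k) gchoose n)) \<and>
         (\<Sum>k = 0..n - 1. fact n * of_nat (eulerian n k) * ((alpha + of_nat k) gchoose n))
           = (\<Sum>k = 1..n. fact n * of_nat (stirling2 n k) * (alpha gchoose k) * fact k)"
proof -
  have \<mu>: "partition \<mu>" "\<Sum>\<^sub># \<mu> = n" using assms(3) by (auto simp: partition_of_def)
  have J: "J \<mu> \<in> Sym" "coords monomial_sf (J \<mu>) (replicate_mset n 1) = of_nat (fact n)"
    using assms(1) \<mu> by (auto simp: jack_family_def)
  \<comment> \<open>The product of the first \<open>n\<close> variables represents m_{1^n}; all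
    coefficients in question are read off at this monomial.\<close>
  have exps: "replicate_mset n 1 = exponents (mset_set {..<n})"
    by (simp add: exponents_mset_set)
  have hall: "hall (jack_tilde J \<mu>) (complete_sf (replicate_mset n 1)) =
      mcoeff (jack_tilde J \<mu>) (mset_set {..<n})"
    using hall_homogeneous_1_power[OF jack_tilde_Sym[of J \<mu>, OF J(1)]] by (simp add: complete_sf_def)
  have coords: "coords monomial_sf (jack_tilde J \<mu>) (replicate_mset n 1) =
      mcoeff (jack_tilde J \<mu>) (mset_set {..<n})"
    unfolding exps by (rule coords_monomial_sf[OF jack_tilde_Sym[of J \<mu>, OF J(1)]])
  have "mcoeff (J \<mu>) (mset_set {..<n}) = of_nat (fact n)"
    using J(2) unfolding exps by (simp only: coords_monomial_sf[OF J(1)])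
  \<comment> \<open>The factorial is treated as the image of a natural number, which the
    substitution of 1/\<alpha> fixes; the power of \<alpha> is the scaling factor of
    \<open>jack_tilde\<close>.\<close>
  then have mcoeff_tilde: "mcoeff (jack_tilde J \<mu>) (mset_set {..<n}) = fact n * alpha ^ n"
    by (simp add: jack_tilde_def \<mu>(2) subst_alpha_of_nat mult.commute del: of_nat_fact)
       simp
  have "(\<Sum>k = 0..n - 1. fact n * of_nat (eulerian n k) * ((alpha + of_nat k) gchoose n)) = fact n * alpha ^ n"
    using Worpitzky[OF assms(2), of alpha] by (simp add: mult.assoc flip: sum_distrib_left)
  moreover have "(\<Sum>k = 1..n. fact n * of_nat (stirling2 n k) * (alpha gchoose k) * fact k) = fact n * alpha ^ n"
    using power_eq_sum_stirling2[OF assms(2), of alpha] by (simp add: mult.assoc flip: sum_distrib_left)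
  ultimately show ?thesis using hall coords mcoeff_tilde by simp
qed

end
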